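(* Let $\lambda$ be a partition with $d=\ell(\lambda)$ parts and $\mu$ a partition with $[\mu]\subseteq[\lambda]$. Then $$\frac{\mathrm{rpp}_{\lambda/\mu}(q)}{\mathrm{rpp}_\lambda(q)}=\sum_{D\in\mathcal{OOE}(\lambda/\mu)}q^{p(D)}\prod_{u\in D}\bigl(1-q^{w(u)}\bigr),$$ where $w(i,j)=\lambda_{d+1-i}+i-j$ and $p(D)=\sum_{u\in \mathrm{EP}(D)}w(u)$.
   Context: A reverse plane partition of a skew shape $\theta$ is a filling of $[\theta]$ with nonnegative integers, weakly increasing along rows and down columns; $\mathrm{rpp}_\theta(q)=\sum_T q^{|T|}$ over all of them, $|T|$ being the sum of entries. The content is $c(i,j)=j-i$. Excited diagrams in the region $\Lambda^d=\{(i,j):1\le i\le d,\ j\ge1\}$: start with the cells of $[\mu]$ and repeatedly apply excited moves, where a cell $(i,j)\in D$ is replaced by $(i+1,j+1)$ provided $(i+1,j),(i,j+1),(i+1,j+1)$ are in the region and not in $D$; the set of all resulting diagrams is $\mathcal E(\Lambda^d/\mu)$. Recording in each cell $u\in[\mu]$ the row number of the cell to which $u$ is moved gives a bijection $\varphi$ from $\mathcal E(\Lambda^d/\mu)$ to the set $\mathrm{SSYT}(\mu,d)$ of semistandard Young tableaux of shape $\mu$ with entries at most $d$. $\mathcal{OOE}(\lambda/\mu)=\varphi^{-1}(\mathcal{OOT}(\lambda/\mu))$, where $\mathcal{OOT}(\lambda/\mu)$ is the set of $T\in\mathrm{SSYT}(\mu,d)$ with $c(u)<\lambda_{d+1-T(u)}$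 for all $u\in[\mu]$; explicitly, $\mathcal{OOE}(\lambda/\mu)$ consists of the diagrams $\{(T(u),T(u)+c(u)):u\in[\mu]\}$ for $T\in\mathcal{OOT}(\lambda/\mu)$. Excited peaks $\mathrm{EP}(D)$ of an excited diagram $D$ are defined recursively: $\mathrm{EP}([\mu])=\varnothing$, and if $D'$ is obtained from $D$ by an excited move that moves a cell out of position $u=(i,j)$, then $\mathrm{EP}(D')=(\mathrm{EP}(D)\cup\{u\})\setminus\{(i,j+1),(i+1,j)\}$. This is well defined, independent of the sequence of moves. *)

theory Defs
  imports "HOL-Computational_Algebra.Formal_Laurent_Series"
begin

text \<open>
  Partitions are lists of their nonzero parts, so the number of parts is \<^term>\<open>length\<close>.
  Cells are pairs (row, column), both counted from 1.
\<close>

type_synonym cell = "nat \<times> nat"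

definition is_partition :: "nat list \<Rightarrow> bool" where
  "is_partition l \<longleftrightarrow> sorted_wrt (\<ge>) l \<and> 0 \<notin> set l"

definition part :: "nat list \<Rightarrow> nat \<Rightarrow> nat" where
  "part l i = (if 1 \<le> i \<and> i \<le> length l then l ! (i - 1) else 0)"

definition young :: "nat list \<Rightarrow> cell set" where
  "young l = {(i, j). 1 \<le> i \<and> i \<le> length l \<and> 1 \<le> j \<and> j \<le> part l i}"

definition content :: "cell \<Rightarrow> int" where
  "content = (\<lambda>(i, j). int j - int i)"

definition rows_weak :: "cell set \<Rightarrow> (cell \<Rightarrow> nat) \<Rightarrow> bool" where
  "rows_weak S T \<longleftrightarrow>
     (\<forall>i j j'. (i, j) \<in> S \<and> (i, j') \<in> S \<and> j < j' \<longrightarrow> T (i, j) \<le> T (i, j'))"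

definition cols_weak :: "cell set \<Rightarrow> (cell \<Rightarrow> nat) \<Rightarrow> bool" where
  "cols_weak S T \<longleftrightarrow>
     (\<forall>i i' j. (i, j) \<in> S \<and> (i', j) \<in> S \<and> i < i' \<longrightarrow> T (i, j) \<le> T (i', j))"

definition cols_strict :: "cell set \<Rightarrow> (cell \<Rightarrow> nat) \<Rightarrow> bool" where
  "cols_strict S T \<longleftrightarrow>
     (\<forall>i i' j. (i, j) \<in> S \<and> (i', j) \<in> S \<and> i < i' \<longrightarrow> T (i, j) < T (i', j))"

text \<open>
  A filling of a diagram is a function on all cells that is 0 off the diagram, so that
  fillings can be counted.
\<close>

definition rpps :: "cell set \<Rightarrow> (cell \<Rightarrow> nat) set" where
  "rpps S = {T. rows_weak S T \<and> cols_weak S T \<and> (\<forall>u. u \<notin> S \<longrightarrow> T u = 0)}"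

text \<open>
  The sum of \<open>q\<close> to the size of the filling, over all reverse plane partitions, with like
  powers collected; for a finite diagram each coefficient counts a finite set.
\<close>

definition rpp_gf :: "cell set \<Rightarrow> rat fps" where
  "rpp_gf S = Abs_fps (\<lambda>n. of_nat (card {T \<in> rpps S. (\<Sum>u\<in>S. T u) = n}))"

definition ssyt :: "nat list \<Rightarrow> nat \<Rightarrow> (cell \<Rightarrow> nat) set" where
  "ssyt mu d = {T. rows_weak (young mu) T \<and> cols_strict (young mu) T \<and>
     (\<forall>u \<in> young mu. 1 \<le> T u \<and> T u \<le> d) \<and> (\<forall>u. u \<notin> young mu \<longrightarrow> T u = 0)}"

definition oot :: "nat list \<Rightarrow> nat list \<Rightarrow> (cell \<Rightarrow> nat) set" where
  "oot lam mu = {T \<in> ssyt mu (length lam).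
     \<forall>u \<in> young mu. content u < int (part lam (length lam + 1 - T u))}"

definition region :: "nat \<Rightarrow> cell set" where
  "region d = {(i, j). 1 \<le> i \<and> i \<le> d \<and> 1 \<le> j}"

definition excited_move :: "nat \<Rightarrow> cell \<Rightarrow> cell set \<Rightarrow> cell set \<Rightarrow> bool" where
  "excited_move d = (\<lambda>(i, j) D D'.
     (i, j) \<in> D \<and> {(i + 1, j), (i, j + 1), (i + 1, j + 1)} \<subseteq> region d - D \<and>
     D' = insert (i + 1, j + 1) (D - {(i, j)}))"

inductive_set excited_diagrams :: "nat \<Rightarrow> nat list \<Rightarrow> cell set set"
  for d :: nat and mu :: "nat list" where
  start: "young mu \<in> excited_diagrams d mu"
| move: "D \<in> excited_diagrams d mu \<Longrightarrow> excited_move d u D D' \<Longrightarrow> D' \<in> excited_diagrams d mu"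

text \<open>
  The relation \<open>peaks d mu D P\<close>: the recursion for excited peaks along some sequence of moves
  from the diagram of \<open>mu\<close> to \<open>D\<close> yields \<open>P\<close>. The result does not depend on the sequence,
  which is what justifies the definite description in \<open>excited_peaks\<close>.
\<close>

inductive peaks :: "nat \<Rightarrow> nat list \<Rightarrow> cell set \<Rightarrow> cell set \<Rightarrow> bool"
  for d :: nat and mu :: "nat list" where
  start: "peaks d mu (young mu) {}"
| move: "peaks d mu D P \<Longrightarrow> excited_move d (i, j) D D' \<Longrightarrow>
     peaks d mu D' ((P \<union> {(i, j)}) - {(i, j + 1), (i + 1, j)})"

definition excited_peaks :: "nat \<Rightarrow> nat list \<Rightarrow> cell set \<Rightarrow> cell set" where
  "excited_peaks d mu D = (THE P. peaks d mu D P)"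

text \<open>
  The excited diagram whose table of row numbers is \<open>T\<close>: excited moves preserve contents, so
  \<open>u\<close> ends up in row \<open>T u\<close> on its own diagonal. In a semistandard tableau an entry is at
  least its row number, hence the truncation to \<^typ>\<open>nat\<close> is harmless.
\<close>

definition tableau_diagram :: "nat list \<Rightarrow> (cell \<Rightarrow> nat) \<Rightarrow> cell set" where
  "tableau_diagram mu T = (\<lambda>u. (T u, nat (int (T u) + content u))) ` young mu"

text \<open>
  The preimage of \<open>oot lam mu\<close> under the map recording row numbers: that map sends an excited
  diagram \<open>D\<close> to the semistandard tableau \<open>T\<close> with \<open>D = tableau_diagram mu T\<close>.
\<close>

definition ooe :: "nat list \<Rightarrow> nat list \<Rightarrow> cell set set" where
  "ooe lam mu = {D \<in> excited_diagrams (length lam) mu. \<exists>T \<in> oot lam mu. D = tableau_diagram mu T}"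

text \<open>
  Weights are integers because they can be negative on general cells of the region; powers
  of \<open>q\<close> are therefore taken in Laurent series.
\<close>

definition weight :: "nat list \<Rightarrow> cell \<Rightarrow> int" where
  "weight lam = (\<lambda>(i, j). int (part lam (length lam + 1 - i)) + int i - int j)"

definition peak_weight :: "nat list \<Rightarrow> nat list \<Rightarrow> cell set \<Rightarrow> int" where
  "peak_weight lam mu D = (\<Sum>u \<in> excited_peaks (length lam) mu D. weight lam u)"

end

theory Submission
  imports Defs "HOL-Library.FuncSet"
begin

text \<open>
  For a cell \<open>u\<close> and a row number \<open>k\<close> put \<open>z u k = q powi (part lam (d + 1 - k) - content u)\<close>.
  This is \<open>q\<close> to the weight of the position of \<open>u\<close> after it has been moved to row \<open>k\<close>. The peaks of
  the excited diagram with tableau \<open>T\<close> turn out to be the positions of the cells \<open>u\<close> in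
  those rows \<open>k < T u\<close> that exceed the entry above \<open>u\<close> and are at least the entry to the left of \<open>u\<close>
  (\<open>peak_weight_eq\<close>). So the right-hand side is a sum of the products \<open>wmax z S T\<close> with \<open>S\<close> the diagram
  of \<open>mu\<close>. It may be extended to all semistandard tableaux, since the others contain
  a factor \<open>1 - q powi 0\<close>. This gives a function \<open>F\<close> that makes sense for every diagram \<open>S\<close>.

  With \<open>G S\<close> the generating function of reverse plane partitions on \<open>young lam - S\<close>, both \<open>H = F\<close>
  and \<open>H = G\<close> satisfy
  \<open>(\<Sum>A. (-1) ^ card A * H (S \<union> A)) = q ^ card (young lam - S) * H S\<close>,
  where \<open>A\<close> runs over the sets of outer corners of \<open>S\<close> in \<open>young lam\<close>. This determines \<open>H\<close> up to a
  constant factor (\<open>alternating_recurrence_unique\<close>), and \<open>F {} = 1\<close> shows that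
  \<open>F S = G S / G {}\<close>.

  For \<open>G\<close> the recurrence is inclusion and exclusion over the corners with entry 0
  (\<open>alternating_rpp_gf\<close>). For \<open>F\<close>, a new corner multiplies the weight of a tableau by a telescoping
  sum, so that the left-hand side becomes a sum over the tableaux on \<open>S\<close>, in which the weight of \<open>T\<close>
  is multiplied by all \<open>z a k\<close> for outer corners \<open>a\<close> and possible entries \<open>k\<close>
  (\<open>alternating_wsum\<close>). An exact count of exponents identifies this with
  \<open>q ^ card (young lam - S)\<close> times a second weight \<open>wmin\<close> of the same tableau
  (\<open>wmax_corners_eq_wmin\<close>). Finally the weights \<open>wmax\<close> and \<open>wmin\<close> have the same total over all
  tableaux, since both arise from one signed sum over set-valued tableaux, grouped by maxima
  or by minima (\<open>sum_wmax_eq_sum_wmin\<close>).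
\<close>

section \<open>Diagrams and tableaux\<close>

definition diagram :: "cell set \<Rightarrow> bool" where
  "diagram S \<longleftrightarrow> finite S \<and> (\<forall>i j. (i, j) \<in> S \<longrightarrow> 1 \<le> i \<and> 1 \<le> j) \<and>
     (\<forall>i j i' j'. (i, j) \<in> S \<and> 1 \<le> i' \<and> i' \<le> i \<and> 1 \<le> j' \<and> j' \<le> j \<longrightarrow> (i', j') \<in> S)"

definition outer_corners :: "cell set \<Rightarrow> cell set" where
  "outer_corners S = {(i, j). 1 \<le> i \<and> 1 \<le> j \<and> (i, j) \<notin> S \<and>
     (i = 1 \<or> (i - 1, j) \<in> S) \<and> (j = 1 \<or> (i, j - 1) \<in> S)}"

text \<open>
  Semistandard tableaux with entries at most \<open>d\<close>, on an arbitrary set of cells: corners will be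
  added one at a time, and shapes given by lists of parts would be awkward for that.
\<close>

definition tableaux :: "cell set \<Rightarrow> nat \<Rightarrow> (cell \<Rightarrow> nat) set" where
  "tableaux S d = {T. rows_weak S T \<and> cols_strict S T \<and>
     (\<forall>u\<in>S. 1 \<le> T u \<and> T u \<le> d) \<and> (\<forall>u. u \<notin> S \<longrightarrow> T u = 0)}"

text \<open>
  The smallest entry that the neighbours to the left and above leave to a cell. In row 1 or
  column 1 the neighbour has an index 0, lies off the diagram and holds 0, which makes the
  bound the right one there too.
\<close>

fun least_entry :: "(cell \<Rightarrow> nat) \<Rightarrow> cell \<Rightarrow> nat" where
  "least_entry T (i, j) = max (T (i, j - 1)) (T (i - 1, j) + 1)"

fun greatest_entry :: "cell set \<Rightarrow> nat \<Rightarrow> (cell \<Rightarrow> nat) \<Rightarrow> cell \<Rightarrow> nat" where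
  "greatest_entry S d T (i, j) =
     min (if (i, j + 1) \<in> S then T (i, j + 1) else d)
         (if (i + 1, j) \<in> S then T (i + 1, j) - 1 else d)"

lemma diagramD:
  assumes "diagram S"
  shows "finite S" and "(i, j) \<in> S \<Longrightarrow> 1 \<le> i" and "(i, j) \<in> S \<Longrightarrow> 1 \<le> j"
    and "(i, j) \<in> S \<Longrightarrow> 1 \<le> i' \<Longrightarrow> i' \<le> i \<Longrightarrow> 1 \<le> j' \<Longrightarrow> j' \<le> j \<Longrightarrow> (i', j') \<in> S"
  using assms unfolding diagram_def by blast+

lemma finite_outer_corners:
  assumes "diagram S"
  shows "finite (outer_corners S)"
proof (rule finite_subset)
  show "outer_corners S \<subseteq> insert 1 (Suc ` fst ` S) \<times> insert 1 (Suc ` snd ` S)"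
  proof
    fix u assume "u \<in> outer_corners S"
    then obtain i j where u: "u = (i, j)" "1 \<le> i" "1 \<le> j"
      "i = 1 \<or> (i - 1, j) \<in> S" "j = 1 \<or> (i, j - 1) \<in> S"
      by (auto simp: outer_corners_def)
    have "i \<in> insert 1 (Suc ` fst ` S)"
      using u by (cases "i = 1") (auto simp: image_iff intro!: bexI[of _ "(i - 1, j)"])
    moreover have "j \<in> insert 1 (Suc ` snd ` S)"
      using u by (cases "j = 1") (auto simp: image_iff intro!: bexI[of _ "(i, j - 1)"])
    ultimately show "u \<in> insert 1 (Suc ` fst ` S) \<times> insert 1 (Suc ` snd ` S)"
      using u(1) by blast
  qed
  show "finite (insert 1 (Suc ` fst ` S) \<times> insert 1 (Suc ` snd ` S))"
    using diagramD(1)[OF assms] by simp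
qed

lemma diagram_Un_outer_corners:
  assumes S: "diagram S" and A: "A \<subseteq> outer_corners S"
  shows "diagram (S \<union> A)"
  unfolding diagram_def
proof (intro conjI allI impI)
  show "finite (S \<union> A)"
    using S A finite_outer_corners finite_subset diagramD(1) by blast
  fix i j
  assume "(i, j) \<in> S \<union> A"
  then show "1 \<le> i" and "1 \<le> j"
    using A diagramD(2,3)[OF S] by (auto simp: outer_corners_def)
next
  fix i j i' j'
  assume a: "(i, j) \<in> S \<union> A \<and> 1 \<le> i' \<and> i' \<le> i \<and> 1 \<le> j' \<and> j' \<le> j"
  show "(i', j') \<in> S \<union> A"
  proof (cases "(i, j) \<in> S \<or> (i', j') = (i, j)")
    case True
    then show ?thesis using a diagramD(4)[OF S] by blast
  next
    case False
    then have c: "(i, j) \<in> outer_corners S" and "i' < i \<or> j' < j"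
      using a A by auto
    then show ?thesis
    proof (elim disjE)
      assume "i' < i"
      then have "(i - 1, j) \<in> S" using c a by (auto simp: outer_corners_def)
      then show ?thesis using a \<open>i' < i\<close> diagramD(4)[OF S, of "i - 1" j i' j'] by simp
    next
      assume "j' < j"
      then have "(i, j - 1) \<in> S" using c a by (auto simp: outer_corners_def)
      then show ?thesis using a \<open>j' < j\<close> diagramD(4)[OF S, of i "j - 1" i' j'] by simp
    qed
  qed
qed

lemma outer_corners_Un:
  "a \<in> outer_corners S \<Longrightarrow> a \<notin> A \<Longrightarrow> a \<in> outer_corners (S \<union> A)"
  by (auto simp: outer_corners_def)

lemma tableaux_zero: "T \<in> tableaux S d \<Longrightarrow> u \<notin> S \<Longrightarrow> T u = 0"
  unfolding tableaux_def by blast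

lemma tableaux_pos: "T \<in> tableaux S d \<Longrightarrow> u \<in> S \<Longrightarrow> 1 \<le> T u"
  by (auto simp: tableaux_def)

lemma tableaux_le: "T \<in> tableaux S d \<Longrightarrow> T u \<le> d"
  using tableaux_zero[of T S d u] by (cases "u \<in> S") (simp_all add: tableaux_def)

lemma tableaux_row_mono:
  assumes T: "T \<in> tableaux S d" and "(i, j') \<in> S" "(i, j) \<in> S" "j \<le> j'"
  shows "T (i, j) \<le> T (i, j')"
  using assms unfolding tableaux_def rows_weak_def
  by (cases "j = j'") auto

lemma tableaux_col_mono:
  assumes T: "T \<in> tableaux S d" and "(i', j) \<in> S" "(i, j) \<in> S" "i < i'"
  shows "T (i, j) < T (i', j)"
  using assms unfolding tableaux_def cols_strict_def by blast

text \<open>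
  Weakly increasing rows and strictly increasing columns can be tested on adjacent cells,
  because a diagram has no gaps between two of its cells.
\<close>

lemma tableaux_iff_least_entry:
  assumes S: "diagram S"
  shows "T \<in> tableaux S d \<longleftrightarrow>
    (\<forall>u\<in>S. least_entry T u \<le> T u \<and> T u \<le> d) \<and> (\<forall>u. u \<notin> S \<longrightarrow> T u = 0)"
proof (intro iffI conjI ballI)
  fix u assume T: "T \<in> tableaux S d" and u: "u \<in> S"
  obtain i j where ij: "u = (i, j)" by fastforce
  have "T (i, j - 1) \<le> T (i, j)"
    using tableaux_row_mono[OF T, of i j "j - 1"] tableaux_zero[OF T, of "(i, j - 1)"] u ij
    by (cases "(i, j - 1) \<in> S") auto
  moreover have "T (i - 1, j) < T (i, j)"
  proof (cases "(i - 1, j) \<in> S")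
    case True
    then have "i - 1 < i" using diagramD(2)[OF S True] by simp
    with True show ?thesis using tableaux_col_mono[OF T, of i j "i - 1"] u ij by simp
  next
    case False
    then show ?thesis using tableaux_zero[OF T False] tableaux_pos[OF T u] ij by simp
  qed
  ultimately show "least_entry T u \<le> T u" by (simp add: ij)
  show "T u \<le> d" using T by (rule tableaux_le)
next
  assume "T \<in> tableaux S d"
  then show "\<forall>u. u \<notin> S \<longrightarrow> T u = 0" using tableaux_zero by blast
next
  assume R: "(\<forall>u\<in>S. least_entry T u \<le> T u \<and> T u \<le> d) \<and> (\<forall>u. u \<notin> S \<longrightarrow> T u = 0)"
  have row: "T (i, j) \<le> T (i, j + k)" if "(i, j + k) \<in> S" "1 \<le> j" for i j k
    using that
  proof (induction k)
    case (Suc k)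
    have "(i, j + k) \<in> S"
      using diagramD(4)[OF S Suc.prems(1), of i "j + k"] diagramD(2)[OF S Suc.prems(1)] Suc.prems
      by simp
    with Suc have "T (i, j) \<le> T (i, j + k)" by simp
    also have "\<dots> \<le> T (i, j + Suc k)" using R Suc.prems(1) by (auto dest!: bspec)
    finally show ?case .
  qed simp
  have col: "T (i, j) < T (i + Suc k, j)" if "(i + Suc k, j) \<in> S" "1 \<le> i" for i j k
    using that
  proof (induction k)
    case 0
    then show ?case using R by (auto dest!: bspec)
  next
    case (Suc k)
    have "(i + Suc k, j) \<in> S"
      using diagramD(4)[OF S Suc.prems(1), of "i + Suc k" j] diagramD(3)[OF S Suc.prems(1)] Suc.prems
      by simp
    with Suc have "T (i, j) < T (i + Suc k, j)" by simp
    also have "\<dots> < T (i + Suc (Suc k), j)" using R Suc.prems(1) by (auto dest!: bspec)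
    finally show ?case .
  qed
  have "rows_weak S T"
    unfolding rows_weak_def
  proof (intro allI impI)
    fix i j j' assume a: "(i, j) \<in> S \<and> (i, j') \<in> S \<and> j < j'"
    then show "T (i, j) \<le> T (i, j')"
      using row[of i j "j' - j"] diagramD(3)[OF S] by auto
  qed
  moreover have "cols_strict S T"
    unfolding cols_strict_def
  proof (intro allI impI)
    fix i i' j assume a: "(i, j) \<in> S \<and> (i', j) \<in> S \<and> i < i'"
    then show "T (i, j) < T (i', j)"
      using col[of i "i' - Suc i" j] diagramD(2)[OF S] by auto
  qed
  moreover have "1 \<le> T u" if "u \<in> S" for u
    using R that by (cases u) (auto dest!: bspec)
  ultimately show "T \<in> tableaux S d"
    using R by (auto simp: tableaux_def)
qed

lemma least_entry_le:
  assumes "diagram S" "T \<in> tableaux S d" "u \<in> S"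
  shows "least_entry T u \<le> T u"
  using assms tableaux_iff_least_entry by blast

lemma greatest_entry_ge:
  assumes S: "diagram S" and T: "T \<in> tableaux S d" and u: "u \<in> S"
  shows "T u \<le> greatest_entry S d T u"
proof -
  obtain i j where ij: "u = (i, j)" by fastforce
  show ?thesis
    using tableaux_row_mono[OF T, of i "j + 1" j] tableaux_col_mono[OF T, of "i + 1" j i] u
      tableaux_le[OF T, of u]
    unfolding ij by fastforce
qed

section \<open>Two weights on tableaux with the same sum\<close>

text \<open>
  A product of finite sets, one for each cell of \<open>S\<close>, with the off-diagram value 0 that
  tableaux use.
\<close>

definition fillings :: "cell set \<Rightarrow> (cell \<Rightarrow> nat set) \<Rightarrow> (cell \<Rightarrow> nat) set" where
  "fillings S B = {f. (\<forall>u\<in>S. f u \<in> B u) \<and> (\<forall>u. u \<notin> S \<longrightarrow> f u = 0)}"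

lemma bij_betw_fillings_PiE:
  "bij_betw (\<lambda>f. restrict f S) (fillings S B) (Pi\<^sub>E S B)"
proof (rule bij_betwI[where g = "\<lambda>f u. if u \<in> S then f u else 0"])
  show "(\<lambda>f. restrict f S) \<in> fillings S B \<rightarrow> Pi\<^sub>E S B"
    by (auto simp: fillings_def)
  show "(\<lambda>f u. if u \<in> S then f u else 0) \<in> Pi\<^sub>E S B \<rightarrow> fillings S B"
    by (auto simp: fillings_def)
qed (auto simp: fillings_def fun_eq_iff restrict_def PiE_def extensional_def)

lemma finite_fillings:
  assumes "finite S" "\<And>u. u \<in> S \<Longrightarrow> finite (B u)"
  shows "finite (fillings S B)"
  using bij_betw_finite[OF bij_betw_fillings_PiE[of S B]] finite_PiE[of S B] assms by blast

lemma sum_fillings_prod: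
  fixes h :: "cell \<Rightarrow> nat \<Rightarrow> 'a::comm_ring_1"
  assumes fin: "finite S" "\<And>u. u \<in> S \<Longrightarrow> finite (B u)"
  shows "(\<Sum>f\<in>fillings S B. \<Prod>u\<in>S. h u (f u)) = (\<Prod>u\<in>S. \<Sum>y\<in>B u. h u y)"
proof -
  have "(\<Sum>f\<in>fillings S B. \<Prod>u\<in>S. h u (f u)) =
      (\<Sum>f\<in>fillings S B. \<Prod>u\<in>S. h u (restrict f S u))"
    by (intro sum.cong prod.cong) auto
  also have "\<dots> = (\<Sum>f\<in>Pi\<^sub>E S B. \<Prod>u\<in>S. h u (f u))"
    by (rule sum.reindex_bij_betw[OF bij_betw_fillings_PiE])
  also have "\<dots> = (\<Prod>u\<in>S. \<Sum>y\<in>B u. h u y)"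
    using fin by (simp add: prod_sum_PiE)
  finally show ?thesis .
qed

lemma finite_tableaux:
  assumes "diagram S"
  shows "finite (tableaux S d)"
proof (rule finite_subset)
  show "tableaux S d \<subseteq> fillings S (\<lambda>_. {..d})"
    by (auto simp: tableaux_def fillings_def)
  show "finite (fillings S (\<lambda>_. {..d}))"
    using diagramD(1)[OF assms] by (intro finite_fillings) auto
qed

text \<open>
  Give a set-valued tableau \<open>U\<close>, whose entries are nonempty sets, the weight
  \<open>\<Prod>u. (-1) ^ (card (U u) - 1) * (\<Prod>k\<in>U u. 1 - z u k)\<close>. If the maxima \<open>T u\<close> of its entries
  are prescribed, the remaining elements of \<open>U u\<close> can be chosen freely between the least
  possible entry and \<open>T u\<close>, and each free choice between \<open>k \<notin> U u\<close> and \<open>k \<in> U u\<close> contributes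
  \<open>1 - (1 - z u k) = z u k\<close>. This sum is \<open>wmax\<close>; prescribing the minima gives \<open>wmin\<close>. For
  suitable \<open>z\<close> the total is a factorial Grothendieck polynomial.
\<close>

definition wmax :: "(cell \<Rightarrow> nat \<Rightarrow> 'a::comm_ring_1) \<Rightarrow> cell set \<Rightarrow> (cell \<Rightarrow> nat) \<Rightarrow> 'a" where
  "wmax z S T = (\<Prod>u\<in>S. (1 - z u (T u)) * (\<Prod>k\<in>{least_entry T u..<T u}. z u k))"

definition wmin ::
  "(cell \<Rightarrow> nat \<Rightarrow> 'a::comm_ring_1) \<Rightarrow> cell set \<Rightarrow> nat \<Rightarrow> (cell \<Rightarrow> nat) \<Rightarrow> 'a" where
  "wmin z S d T = (\<Prod>u\<in>S. (1 - z u (T u)) * (\<Prod>k\<in>{T u<..greatest_entry S d T u}. z u k))"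

text \<open>
  The signed sum \<open>\<Sum>B. (-1) ^ (card B - 1) * (\<Prod>k\<in>B. 1 - z k)\<close> over the sets \<open>B\<close> with
  minimum \<open>a\<close> and maximum \<open>b\<close>, so that set-valued tableaux can be replaced by the pairs of
  tableaux that record their minima and maxima.
\<close>

definition pair_weight :: "(nat \<Rightarrow> 'a::comm_ring_1) \<Rightarrow> nat \<Rightarrow> nat \<Rightarrow> 'a" where
  "pair_weight z a b =
     (if a = b then 1 - z a else - ((1 - z a) * (1 - z b) * (\<Prod>k\<in>{a<..<b}. z k)))"

lemma sum_pair_weight_upper:
  fixes z :: "nat \<Rightarrow> 'a::comm_ring_1"
  assumes "a \<le> h"
  shows "(\<Sum>b\<in>{a..h}. pair_weight z a b) = (1 - z a) * (\<Prod>k\<in>{a<..h}. z k)"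
  using assms
proof (induction h rule: nat_induct_at_least)
  case base
  then show ?case by (simp add: pair_weight_def)
next
  case (Suc h)
  have "{a..Suc h} = insert (Suc h) {a..h}" "{a<..Suc h} = insert (Suc h) {a<..h}"
    "{a<..<Suc h} = {a<..h}"
    using Suc.hyps by auto
  then show ?case using Suc by (simp add: pair_weight_def algebra_simps)
qed

lemma sum_pair_weight_lower:
  fixes z :: "nat \<Rightarrow> 'a::comm_ring_1"
  assumes "l \<le> b"
  shows "(\<Sum>a\<in>{l..b}. pair_weight z a b) = (1 - z b) * (\<Prod>k\<in>{l..<b}. z k)"
  using assms
proof (induction rule: inc_induct)
  case base
  then show ?case by (simp add: pair_weight_def)
next
  case (step n)
  have "{n..b} = insert n {Suc n..b}" "{n..<b} = insert n {Suc n..<b}" "{n<..<b} = {Suc n..<b}"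
    using step.hyps by auto
  then show ?case using step by (simp add: pair_weight_def algebra_simps)
qed

text \<open>
  The condition under which \<open>m\<close> and \<open>M\<close> are the minima and maxima of a set-valued tableau: its
  rows weakly and its columns strictly increase when every element of one entry is compared with
  every element of the next.
\<close>

definition compatible :: "cell set \<Rightarrow> (cell \<Rightarrow> nat) \<Rightarrow> (cell \<Rightarrow> nat) \<Rightarrow> bool" where
  "compatible S m M \<longleftrightarrow> (\<forall>u\<in>S. least_entry M u \<le> m u \<and> m u \<le> M u)"

lemma compatible_lower:
  assumes S: "diagram S" and M: "M \<in> tableaux S d"
  shows "{m \<in> tableaux S d. compatible S m M} = fillings S (\<lambda>u. {least_entry M u..M u})"
proof (intro set_eqI iffI)
  fix m assume "m \<in> {m \<in> tableaux S d. compatible S m M}"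
  then show "m \<in> fillings S (\<lambda>u. {least_entry M u..M u})"
    using tableaux_zero[of m S d]
    unfolding fillings_def compatible_def mem_Collect_eq atLeastAtMost_iff by blast
next
  fix m assume m: "m \<in> fillings S (\<lambda>u. {least_entry M u..M u})"
  have "m u = 0" if "u \<notin> S" for u
    using m that unfolding fillings_def by blast
  then have le: "m u \<le> M u" for u
    using m by (cases "u \<in> S") (auto simp: fillings_def)
  have "least_entry m u \<le> m u" if "u \<in> S" for u
  proof -
    obtain i j where "u = (i, j)" by fastforce
    then have "least_entry m u \<le> least_entry M u"
      using le[of "(i, j - 1)"] le[of "(i - 1, j)"] by auto
    also have "\<dots> \<le> m u" using m that by (auto simp: fillings_def)
    finally show ?thesis .
  qed
  then have "m \<in> tableaux S d"
    using m le tableaux_le[OF M] le_trans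
    unfolding tableaux_iff_least_entry[OF S] fillings_def by blast
  then show "m \<in> {m \<in> tableaux S d. compatible S m M}"
    using m by (simp add: compatible_def fillings_def)
qed

lemma compatible_upper:
  assumes S: "diagram S" and m: "m \<in> tableaux S d"
  shows "{M \<in> tableaux S d. compatible S m M} = fillings S (\<lambda>u. {m u..greatest_entry S d m u})"
proof (intro set_eqI iffI)
  fix M assume "M \<in> {M \<in> tableaux S d. compatible S m M}"
  then have M: "M \<in> tableaux S d" and c: "\<And>u. u \<in> S \<Longrightarrow> least_entry M u \<le> m u \<and> m u \<le> M u"
    by (auto simp: compatible_def)
  have "M u \<le> greatest_entry S d m u" if u: "u \<in> S" for u
  proof -
    obtain i j where ij: "u = (i, j)" by fastforce
    show ?thesis
      using c[of "(i, j + 1)"] c[of "(i + 1, j)"] tableaux_le[OF M, of u] by (auto simp: ij)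
  qed
  then show "M \<in> fillings S (\<lambda>u. {m u..greatest_entry S d m u})"
    using c tableaux_zero[OF M] by (simp add: fillings_def)
next
  fix M assume f: "M \<in> fillings S (\<lambda>u. {m u..greatest_entry S d m u})"
  have "least_entry M u \<le> m u" if u: "u \<in> S" for u
  proof -
    obtain i j where ij: "u = (i, j)" by fastforce
    have i: "1 \<le> i" "1 \<le> j" using diagramD(2,3)[OF S] u ij by auto
    have "M (i, j - 1) \<le> m (i, j)"
    proof (cases "(i, j - 1) \<in> S")
      case True
      then have "M (i, j - 1) \<le> greatest_entry S d m (i, j - 1)" using f by (auto simp: fillings_def)
      then show ?thesis using u ij i by auto
    next
      case False
      then show ?thesis using f by (auto simp: fillings_def)
    qed
    moreover have "M (i - 1, j) < m (i, j)"
    proof (cases "(i - 1, j) \<in> S")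
      case True
      then have "M (i - 1, j) \<le> greatest_entry S d m (i - 1, j)" using f by (auto simp: fillings_def)
      then show ?thesis using u ij i tableaux_pos[OF m u] by auto
    next
      case False
      then show ?thesis using f tableaux_pos[OF m u] ij by (auto simp: fillings_def)
    qed
    ultimately show ?thesis by (simp add: ij)
  qed
  then have c: "compatible S m M"
    using f by (auto simp: compatible_def fillings_def)
  have "least_entry M u \<le> M u \<and> M u \<le> d" if u: "u \<in> S" for u
  proof -
    have "greatest_entry S d m u \<le> d"
      using tableaux_le[OF m] by (cases u) (auto simp: min_le_iff_disj)
    then show ?thesis using c f u unfolding compatible_def fillings_def by fastforce
  qed
  then have "M \<in> tableaux S d"
    using f unfolding tableaux_iff_least_entry[OF S] fillings_def by blast
  then show "M \<in> {M \<in> tableaux S d. compatible S m M}"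
    using c by blast
qed

text \<open>
  Both sides are the sum of \<open>\<Prod>u\<in>S. pair_weight (z u) (m u) (M u)\<close> over the compatible pairs
  \<open>(m, M)\<close>: for fixed \<open>M\<close>, and likewise for fixed \<open>m\<close>, the
  values of the other tableau at different cells are independent, so the inner sum is a product
  over the cells.
\<close>

lemma sum_wmax_eq_sum_wmin:
  assumes S: "diagram S"
  shows "(\<Sum>T\<in>tableaux S d. wmax z S T) = (\<Sum>T\<in>tableaux S d. wmin z S d T)"
proof -
  have fin: "finite S" by (rule diagramD(1)[OF S])
  let ?w = "\<lambda>m M. \<Prod>u\<in>S. pair_weight (z u) (m u) (M u)"
  have "(\<Sum>m\<in>{m \<in> tableaux S d. compatible S m M}. ?w m M) = wmax z S M"
    if M: "M \<in> tableaux S d" for M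
    unfolding compatible_lower[OF S M] wmax_def
    using fin least_entry_le[OF S M]
    by (subst sum_fillings_prod[where h = "\<lambda>u y. pair_weight (z u) y (M u)"])
       (auto intro!: prod.cong sum_pair_weight_lower)
  moreover have "(\<Sum>M\<in>{M \<in> tableaux S d. compatible S m M}. ?w m M) = wmin z S d m"
    if m: "m \<in> tableaux S d" for m
    unfolding compatible_upper[OF S m] wmin_def
    using fin greatest_entry_ge[OF S m]
    by (subst sum_fillings_prod[where h = "\<lambda>u y. pair_weight (z u) (m u) y"])
       (auto intro!: prod.cong sum_pair_weight_upper)
  ultimately show ?thesis
    using sum.swap_restrict[OF finite_tableaux[OF S, of d] finite_tableaux[OF S, of d],
        where g = "\<lambda>M m. ?w m M" and R = "\<lambda>M m. compatible S m M"]
    by simp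
qed

section \<open>Adding outer corners to a tableau\<close>

lemma sum_telescope:
  fixes z :: "nat \<Rightarrow> 'a::comm_ring_1"
  shows "(\<Sum>t\<in>{l..h}. (1 - z t) * (\<Prod>k\<in>{l..<t}. z k)) = 1 - (\<Prod>k\<in>{l..h}. z k)"
proof (cases "l \<le> h")
  case True
  then show ?thesis
  proof (induction h rule: nat_induct_at_least)
    case (Suc h)
    have "{l..Suc h} = insert (Suc h) {l..h}" "{l..<Suc h} = {l..h}"
      using Suc.hyps by auto
    then show ?case using Suc by (simp add: algebra_simps)
  qed simp
qed simp

lemma least_entry_upd:
  assumes "diagram S" "a \<in> outer_corners S" "u \<in> S \<union> outer_corners S"
  shows "least_entry (T(a := t)) u = least_entry T u"
proof -
  obtain i j where u: "u = (i, j)" by fastforce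
  obtain x y where a: "a = (x, y)" by fastforce
  have a': "(x, y) \<notin> S" "1 \<le> x" "1 \<le> y"
    using assms(2) by (auto simp: a outer_corners_def)
  have "(i, j - 1) \<in> S \<or> j - 1 = 0" "(i - 1, j) \<in> S \<or> i - 1 = 0"
    using assms(3) diagramD(4)[OF assms(1), of i j i "j - 1"]
      diagramD(4)[OF assms(1), of i j "i - 1" j] diagramD(2,3)[OF assms(1), of i j]
    by (auto simp: u outer_corners_def)
  then have "a \<noteq> (i, j - 1)" "a \<noteq> (i - 1, j)"
    using a' by (auto simp: a)
  then show ?thesis by (auto simp: u)
qed

lemma tableaux_insert_iff:
  assumes S: "diagram S" and a: "a \<in> outer_corners S"
  shows "T \<in> tableaux (insert a S) d \<longleftrightarrow>
    T(a := 0) \<in> tableaux S d \<and> T a \<in> {least_entry T a..d}"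
proof -
  have S': "diagram (insert a S)"
    using diagram_Un_outer_corners[OF S, of "{a}"] a by simp
  have aS: "a \<notin> S" using a by (auto simp: outer_corners_def)
  have le: "least_entry (T(a := 0)) u = least_entry T u" if "u \<in> S" for u
    using that by (intro least_entry_upd[OF S a]) simp
  have ne: "(T(a := 0)) u = T u" if "u \<in> S" for u
    using that aS by (cases "u = a") auto
  have "(\<forall>u\<in>S. least_entry (T(a := 0)) u \<le> (T(a := 0)) u \<and> (T(a := 0)) u \<le> d) \<longleftrightarrow>
      (\<forall>u\<in>S. least_entry T u \<le> T u \<and> T u \<le> d)"
    using le ne by (intro ball_cong) auto
  moreover have "(\<forall>u. u \<notin> insert a S \<longrightarrow> T u = 0) \<longleftrightarrow> (\<forall>u. u \<notin> S \<longrightarrow> (T(a := 0)) u = 0)"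
    using aS by (metis fun_upd_apply insert_iff)
  ultimately show ?thesis
    unfolding tableaux_iff_least_entry[OF S] tableaux_iff_least_entry[OF S'] by auto
qed

text \<open>
  The entry of a new corner \<open>a\<close> can be any number from its least entry to \<open>d\<close>, and no other
  bound depends on it. The factors it contributes to \<open>wmax\<close> telescope. The function \<open>g\<close> makes room
  for the factors of corners that have been dealt with before.
\<close>

lemma sum_wmax_insert:
  fixes z :: "cell \<Rightarrow> nat \<Rightarrow> 'a::comm_ring_1"
  assumes S: "diagram S" and a: "a \<in> outer_corners S"
    and g: "\<And>T t. g (T(a := t)) = g T"
  shows "(\<Sum>T\<in>tableaux (insert a S) d. wmax z (insert a S) T * g T) =
    (\<Sum>T\<in>tableaux S d. wmax z S T * ((1 - (\<Prod>k\<in>{least_entry T a..d}. z a k)) * g T))"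
proof -
  have aS: "a \<notin> S" using a by (auto simp: outer_corners_def)
  have fin: "finite S" by (rule diagramD(1)[OF S])
  have la: "least_entry (T(a := t)) a = least_entry T a" for T t
    using a by (intro least_entry_upd[OF S a]) simp
  let ?v = "\<lambda>T t. (1 - z a t) * (\<Prod>k\<in>{least_entry T a..<t}. z a k)"
  have w: "wmax z (insert a S) (T(a := t)) = wmax z S T * ?v T t" for T t
  proof -
    have "wmax z S (T(a := t)) = wmax z S T"
      unfolding wmax_def
    proof (intro prod.cong refl)
      fix u assume "u \<in> S"
      then have "least_entry (T(a := t)) u = least_entry T u" "u \<noteq> a"
        using least_entry_upd[OF S a] aS by auto
      then show "(1 - z u ((T(a := t)) u)) *
          (\<Prod>k = least_entry (T(a := t)) u..<(T(a := t)) u. z u k) =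
          (1 - z u (T u)) * (\<Prod>k = least_entry T u..<T u. z u k)"
        by simp
    qed
    then show ?thesis
      using fin aS unfolding wmax_def by (simp add: la mult.commute)
  qed
  have "(\<Sum>T\<in>tableaux S d. wmax z S T * ((1 - (\<Prod>k\<in>{least_entry T a..d}. z a k)) * g T)) =
      (\<Sum>T\<in>tableaux S d. \<Sum>t\<in>{least_entry T a..d}. wmax z S T * ?v T t * g T)"
    by (simp flip: sum_telescope add: sum_distrib_left sum_distrib_right mult.assoc)
  also have "\<dots> = (\<Sum>(T, t)\<in>Sigma (tableaux S d) (\<lambda>T. {least_entry T a..d}).
      wmax z S T * ?v T t * g T)"
    using finite_tableaux[OF S] by (intro sum.Sigma) auto
  also have "\<dots> = (\<Sum>T\<in>tableaux (insert a S) d. wmax z (insert a S) T * g T)"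
  proof (rule sum.reindex_bij_witness[where j = "\<lambda>(T, t). T(a := t)" and
        i = "\<lambda>T. (T(a := 0), T a)"])
    fix p assume p: "p \<in> Sigma (tableaux S d) (\<lambda>T. {least_entry T a..d})"
    obtain T t where Tt: "p = (T, t)" by fastforce
    have "T a = 0" using p Tt tableaux_zero[of T S d a] aS by auto
    then have T0: "T(a := 0) = T" by auto
    show "((case p of (T, t) \<Rightarrow> T(a := t))(a := 0), (case p of (T, t) \<Rightarrow> T(a := t)) a) = p"
      using T0 Tt by simp
    show "(case p of (T, t) \<Rightarrow> T(a := t)) \<in> tableaux (insert a S) d"
      using p T0 Tt by (simp add: tableaux_insert_iff[OF S a] la)
    show "wmax z (insert a S) (case p of (T, t) \<Rightarrow> T(a := t)) * g (case p of (T, t) \<Rightarrow> T(a := t)) =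
        (case p of (T, t) \<Rightarrow> wmax z S T * ?v T t * g T)"
      using Tt by (simp add: w g)
  next
    fix T assume T: "T \<in> tableaux (insert a S) d"
    show "(case (T(a := 0), T a) of (T, t) \<Rightarrow> T(a := t)) = T" by simp
    show "(T(a := 0), T a) \<in> Sigma (tableaux S d) (\<lambda>T. {least_entry T a..d})"
      using T by (simp add: tableaux_insert_iff[OF S a] la)
  qed
  finally show ?thesis by simp
qed

lemma sum_wmax_Un:
  fixes z :: "cell \<Rightarrow> nat \<Rightarrow> 'a::comm_ring_1"
  assumes S: "diagram S" and A: "A \<subseteq> outer_corners S"
    and g: "\<And>T t a. a \<in> outer_corners S \<Longrightarrow> g (T(a := t)) = g T"
  shows "(\<Sum>T\<in>tableaux (S \<union> A) d. wmax z (S \<union> A) T * g T) =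
    (\<Sum>T\<in>tableaux S d. wmax z S T *
      ((\<Prod>a\<in>A. 1 - (\<Prod>k\<in>{least_entry T a..d}. z a k)) * g T))"
proof -
  have "finite A" using A finite_outer_corners[OF S] finite_subset by blast
  then show ?thesis using A g
  proof (induction A arbitrary: g rule: finite_induct)
    case (insert a A)
    have a: "a \<in> outer_corners (S \<union> A)" "a \<in> outer_corners S"
      using insert.prems(1) insert.hyps outer_corners_Un[of a S A] by auto
    have S': "diagram (S \<union> A)"
      using diagram_Un_outer_corners[OF S] insert.prems(1) by simp
    let ?P = "\<lambda>T a. 1 - (\<Prod>k\<in>{least_entry T a..d}. z a k)"
    have inv: "?P (T(b := t)) a * g (T(b := t)) = ?P T a * g T" if "b \<in> outer_corners S" for T t b
      using least_entry_upd[OF S that, of a T t] a(2)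
      by (simp add: insert.prems(2)[OF that] del: fun_upd_apply)
    have "(\<Sum>T\<in>tableaux (S \<union> insert a A) d. wmax z (S \<union> insert a A) T * g T) =
        (\<Sum>T\<in>tableaux (S \<union> A) d. wmax z (S \<union> A) T * (?P T a * g T))"
      using sum_wmax_insert[OF S' a(1), of g z d] insert.prems(2)[OF a(2)] by simp
    also have "\<dots> = (\<Sum>T\<in>tableaux S d. wmax z S T * ((\<Prod>a\<in>A. ?P T a) * (?P T a * g T)))"
      using insert.prems(1) inv by (intro insert.IH) blast+
    also have "\<dots> = (\<Sum>T\<in>tableaux S d. wmax z S T * ((\<Prod>a\<in>insert a A. ?P T a) * g T))"
      using insert.hyps by (intro sum.cong refl) (simp add: mult_ac)
    finally show ?case .
  qed simp
qed

definition wsum :: "(cell \<Rightarrow> nat \<Rightarrow> 'a::comm_ring_1) \<Rightarrow> nat \<Rightarrow> cell set \<Rightarrow> 'a" where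
  "wsum z d S = (\<Sum>T\<in>tableaux S d. wmax z S T)"

text \<open>
  A set \<open>A\<close> of corners contributes \<open>\<Prod>a\<in>A. 1 - P a\<close>, where \<open>P a\<close> is the product of the
  \<open>z a k\<close> over all possible entries \<open>k\<close> of \<open>a\<close>; the alternating sum over \<open>A\<close> of these products
  is \<open>\<Prod>a. P a\<close>.
\<close>

lemma alternating_wsum:
  fixes z :: "cell \<Rightarrow> nat \<Rightarrow> 'a::comm_ring_1"
  assumes S: "diagram S"
  shows "(\<Sum>A\<in>Pow (outer_corners S). (-1) ^ card A * wsum z d (S \<union> A)) =
    (\<Sum>T\<in>tableaux S d. wmax z S T *
      (\<Prod>a\<in>outer_corners S. \<Prod>k\<in>{least_entry T a..d}. z a k))"
proof -
  let ?C = "outer_corners S"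
  let ?P = "\<lambda>T a. \<Prod>k\<in>{least_entry T a..d}. z a k"
  have fin: "finite ?C" by (rule finite_outer_corners[OF S])
  have "(\<Sum>A\<in>Pow ?C. (-1) ^ card A * wsum z d (S \<union> A)) =
      (\<Sum>A\<in>Pow ?C. \<Sum>T\<in>tableaux S d. wmax z S T * ((-1) ^ card A * (\<Prod>a\<in>A. 1 - ?P T a)))"
  proof (rule sum.cong[OF refl])
    fix A assume "A \<in> Pow ?C"
    then have "wsum z d (S \<union> A) = (\<Sum>T\<in>tableaux S d. wmax z S T * (\<Prod>a\<in>A. 1 - ?P T a))"
      using sum_wmax_Un[OF S, where g = "\<lambda>_. 1"] by (simp add: wsum_def)
    then show "(-1) ^ card A * wsum z d (S \<union> A) =
        (\<Sum>T\<in>tableaux S d. wmax z S T * ((-1) ^ card A * (\<Prod>a\<in>A. 1 - ?P T a)))"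
      by (simp add: sum_distrib_left mult.left_commute)
  qed
  also have "\<dots> = (\<Sum>T\<in>tableaux S d. wmax z S T *
      (\<Sum>A\<in>Pow ?C. (-1) ^ card A * (\<Prod>a\<in>A. 1 - ?P T a)))"
    by (subst sum.swap) (simp add: sum_distrib_left)
  also have "\<dots> = (\<Sum>T\<in>tableaux S d. wmax z S T * (\<Prod>a\<in>?C. ?P T a))"
  proof (intro sum.cong refl arg_cong2[where f = "(*)"])
    fix T
    show "(\<Sum>A\<in>Pow ?C. (-1) ^ card A * (\<Prod>a\<in>A. 1 - ?P T a)) = (\<Prod>a\<in>?C. ?P T a)"
      using prod_diff_conv_sum[OF fin, of "\<lambda>_. 1" "\<lambda>a. 1 - ?P T a"] by simp
  qed
  finally show ?thesis .
qed

section \<open>Comparing the two weights of a single tableau\<close>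

lemma tableaux_row_le:
  assumes S: "diagram S" and T: "T \<in> tableaux S d" and u: "(i, j) \<in> S"
  shows "i \<le> T (i, j)"
  using u
proof (induction i)
  case (Suc i)
  show ?case
  proof (cases "i = 0")
    case True
    then show ?thesis using tableaux_pos[OF T Suc.prems] by simp
  next
    case False
    then have "(i, j) \<in> S"
      using diagramD(4)[OF S Suc.prems, of i j] diagramD(3)[OF S Suc.prems] by simp
    then show ?thesis
      using Suc.IH tableaux_col_mono[OF T Suc.prems, of i] by simp
  qed
qed simp

lemma initial_segment_eq:
  fixes A :: "nat set"
  assumes "finite A" and "\<And>j. j \<in> A \<Longrightarrow> 1 \<le> j"
    and "\<And>j j'. j \<in> A \<Longrightarrow> 1 \<le> j' \<Longrightarrow> j' \<le> j \<Longrightarrow> j' \<in> A"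
  shows "A = {1..card A}"
proof (cases "A = {}")
  case False
  then have "Max A \<in> A" using assms(1) by (rule Max_in[rotated])
  then have "j \<in> A \<longleftrightarrow> j \<in> {1..Max A}" for j
    using assms(2)[of j] assms(3)[of "Max A" j] Max_ge[OF assms(1), of j] by auto
  then have A: "A = {1..Max A}" by (rule set_eqI)
  have "card A = Max A"
    using arg_cong[OF A, of card] by simp
  then show ?thesis using A by argo
qed simp

text \<open>
  The cells with entry at most \<open>k\<close> form a diagram inside \<open>S\<close>; these are its row lengths.
\<close>

definition row_count :: "cell set \<Rightarrow> (cell \<Rightarrow> nat) \<Rightarrow> nat \<Rightarrow> nat \<Rightarrow> nat" where
  "row_count S T k i = card {j. (i, j) \<in> S \<and> T (i, j) \<le> k}"

lemma row_count_iff: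
  assumes S: "diagram S" and T: "T \<in> tableaux S d"
  shows "(i, j) \<in> S \<and> T (i, j) \<le> k \<longleftrightarrow> 1 \<le> j \<and> j \<le> row_count S T k i"
proof -
  let ?A = "{j. (i, j) \<in> S \<and> T (i, j) \<le> k}"
  have "?A = {1..card ?A}"
  proof (rule initial_segment_eq)
    show "finite ?A"
      using diagramD(1)[OF S] by (rule finite_subset[rotated, OF finite_imageI[of S snd]]) force
    show "1 \<le> j" if "j \<in> ?A" for j using that diagramD(3)[OF S] by blast
    show "j' \<in> ?A" if "j \<in> ?A" "1 \<le> j'" "j' \<le> j" for j j'
    proof -
      have "(i, j') \<in> S" using diagramD(4)[OF S, of i j i j'] diagramD(2)[OF S, of i j] that by auto
      moreover from this have "T (i, j') \<le> T (i, j)"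
        using that tableaux_row_mono[OF T] by blast
      ultimately show ?thesis using that by auto
    qed
  qed
  then have "j \<in> ?A \<longleftrightarrow> j \<in> {1..card ?A}" by simp
  then show ?thesis by (simp add: row_count_def)
qed

lemma sum_row_count:
  assumes S: "diagram S" and T: "T \<in> tableaux S d"
  shows "(\<Sum>i\<in>{1..d}. row_count S T k i) = card {u \<in> S. T u \<le> k}"
proof -
  have "i \<in> {1..d}" if "(i, j) \<in> S" for i j
    using diagramD(2)[OF S that] tableaux_row_le[OF S T that] tableaux_le[OF T, of "(i, j)"] by simp
  then have "{u \<in> S. T u \<le> k} = Sigma {1..d} (\<lambda>i. {j. (i, j) \<in> S \<and> T (i, j) \<le> k})"
    by auto
  moreover have "finite {j. (i, j) \<in> S \<and> T (i, j) \<le> k}" for i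
    using diagramD(1)[OF S] by (rule finite_subset[rotated, OF finite_imageI[of S snd]]) force
  ultimately show ?thesis by (simp add: row_count_def)
qed

text \<open>
  The cells whose entry is exactly \<open>k\<close> form a horizontal strip, because columns strictly increase.
\<close>

lemma row_count_below:
  assumes S: "diagram S" and T: "T \<in> tableaux S d" and "1 \<le> i" "1 \<le> k"
  shows "row_count S T k (i + 1) \<le> row_count S T (k - 1) i"
proof (cases "row_count S T k (i + 1) = 0")
  case False
  let ?j = "row_count S T k (i + 1)"
  have u: "(i + 1, ?j) \<in> S" "T (i + 1, ?j) \<le> k"
    using row_count_iff[OF S T, of "i + 1" ?j k] False by auto
  have "(i, ?j) \<in> S" using diagramD(4)[OF S u(1), of i ?j] assms(3) False by simp
  moreover from this have "T (i, ?j) < T (i + 1, ?j)"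
    using tableaux_col_mono[OF T u(1)] by simp
  then have "T (i, ?j) \<le> k - 1" using u(2) by linarith
  ultimately show ?thesis
    using row_count_iff[OF S T, of i ?j "k - 1"] by blast
qed simp

text \<open>
  The rows in which the last cell with entry less than \<open>k\<close> has no cell with entry at most \<open>k\<close> below
  it. Such a row accounts for one factor with row number \<open>k\<close> in \<open>wmin\<close>, at that last cell, and for
  one factor in \<open>wmax\<close>, at the first cell of the next row whose entry exceeds \<open>k\<close>. The outer
  corners count as cells with entry \<open>d + 1\<close>.
\<close>

definition steps :: "cell set \<Rightarrow> nat \<Rightarrow> (cell \<Rightarrow> nat) \<Rightarrow> nat \<Rightarrow> nat set" where
  "steps S d T k = {i \<in> {1..d}. row_count S T k (i + 1) < row_count S T (k - 1) i}"

text \<open>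
  The first row contributes one more cell than \<open>steps\<close> accounts for: no cell above it can prevent
  the value \<open>k\<close> from being skipped there.
\<close>

lemma skipped_below_entry:
  assumes S: "diagram S" and T: "T \<in> tableaux S d" and k: "k \<in> {1..d}"
  shows "{u \<in> S \<union> outer_corners S. least_entry T u \<le> k \<and> (u \<in> S \<longrightarrow> k < T u)} =
    insert (1, row_count S T k 1 + 1)
      ((\<lambda>i. (i + 1, row_count S T k (i + 1) + 1)) ` steps S d T k)" (is "?M = ?R")
proof (rule set_eqI, rule iffI)
  fix u assume u: "u \<in> ?M"
  obtain i j where ij: "u = (i, j)" by fastforce
  let ?b = "row_count S T k i"
  have ge: "1 \<le> i" "1 \<le> j"
    using u diagramD(2-3)[OF S] by (auto simp: ij outer_corners_def)
  then have left: "j = 1 \<or> (i, j - 1) \<in> S" and up: "i = 1 \<or> (i - 1, j) \<in> S"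
    using u diagramD(4)[OF S, of i j i "j - 1"]
      diagramD(4)[OF S, of i j "i - 1" j]
    by (cases "j = 1"; cases "i = 1"; auto simp: ij outer_corners_def)+
  have lo: "T (i, j - 1) \<le> k" "T (i - 1, j) \<le> k - 1" using u by (auto simp: ij)
  have "\<not> j \<le> ?b"
    using u ge row_count_iff[OF S T, of i j k] by (auto simp: ij)
  moreover have "j - 1 \<le> ?b"
    using left lo row_count_iff[OF S T, of i "j - 1" k] by auto
  ultimately have j: "j = ?b + 1" by simp
  show "u \<in> ?R"
  proof (cases "i = 1")
    case True
    then show ?thesis using j ij by simp
  next
    case False
    then have S': "(i - 1, j) \<in> S" using up by simp
    then have "j \<le> row_count S T (k - 1) (i - 1)"
      using row_count_iff[OF S T, of "i - 1" j "k - 1"] lo by simp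
    moreover have "i - 1 \<le> d"
      using tableaux_row_le[OF S T S'] tableaux_le[OF T, of "(i - 1, j)"] by simp
    ultimately have "i - 1 \<in> steps S d T k"
      using j False ge by (simp add: steps_def)
    moreover have "u = ((i - 1) + 1, row_count S T k ((i - 1) + 1) + 1)"
      using j ij ge by simp
    ultimately show ?thesis by blast
  qed
next
  have *: "(i, row_count S T k i + 1) \<in> ?M"
    if "1 \<le> i" and up: "i = 1 \<or> (i - 1, row_count S T k i + 1) \<in> S"
      and lt: "T (i - 1, row_count S T k i + 1) < k" for i
  proof -
    let ?b = "row_count S T k i"
    have nle: "\<not> ((i, ?b + 1) \<in> S \<and> T (i, ?b + 1) \<le> k)"
      using row_count_iff[OF S T, of i "?b + 1" k] by simp
    have b: "?b = 0 \<or> (i, ?b) \<in> S \<and> T (i, ?b) \<le> k"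
      using row_count_iff[OF S T, of i ?b k] by linarith
    have "(i, 0) \<notin> S" using diagramD(3)[OF S, of i 0] by auto
    then have "T (i, ?b) \<le> k"
      using b tableaux_zero[OF T, of "(i, 0)"] by auto
    then show ?thesis
      using that nle b by (auto simp: outer_corners_def)
  qed
  fix u assume "u \<in> ?R"
  then consider "u = (1, row_count S T k 1 + 1)"
    | i where "i \<in> steps S d T k" "u = (i + 1, row_count S T k (i + 1) + 1)" by blast
  then show "u \<in> ?M"
  proof cases
    case 1
    have "T (0, row_count S T k 1 + 1) = 0"
      using tableaux_zero[OF T] diagramD(2)[OF S] by fastforce
    then show ?thesis using *[of 1] 1 k by simp
  next
    case 2
    then show ?thesis
      using *[of "i + 1"] row_count_iff[OF S T, of i "row_count S T k (i + 1) + 1" "k - 1"] k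
      by (auto simp: steps_def)
  qed
qed

lemma skipped_above_entry:
  assumes S: "diagram S" and T: "T \<in> tableaux S d" and k: "k \<in> {1..d}"
  shows "{u \<in> S. T u < k \<and> k \<le> greatest_entry S d T u} =
    (\<lambda>i. (i, row_count S T (k - 1) i)) ` steps S d T k" (is "?N = ?R")
proof (rule set_eqI, rule iffI)
  fix u assume u: "u \<in> ?N"
  obtain i j where ij: "u = (i, j)" by fastforce
  have S': "(i, j) \<in> S" "T (i, j) \<le> k - 1" using u ij by auto
  have "j \<le> row_count S T (k - 1) i"
    using row_count_iff[OF S T, of i j "k - 1"] S' by simp
  moreover have "\<not> j + 1 \<le> row_count S T (k - 1) i"
    using row_count_iff[OF S T, of i "j + 1" "k - 1"] u k by (auto simp: ij)
  moreover have "\<not> j \<le> row_count S T k (i + 1)"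
    using row_count_iff[OF S T, of "i + 1" j k] u k diagramD(3)[OF S S'(1)] by (auto simp: ij)
  ultimately have "j = row_count S T (k - 1) i" "row_count S T k (i + 1) < j" by auto
  moreover have "i \<in> {1..d}"
    using tableaux_row_le[OF S T S'(1)] tableaux_le[OF T, of "(i, j)"] diagramD(2)[OF S S'(1)] by simp
  ultimately show "u \<in> ?R" by (auto simp: ij steps_def)
next
  fix u assume "u \<in> ?R"
  then obtain i where i: "i \<in> steps S d T k" and u: "u = (i, row_count S T (k - 1) i)" by blast
  let ?j = "row_count S T (k - 1) i"
  have lt: "row_count S T k (i + 1) < ?j" using i by (simp add: steps_def)
  have "(i, ?j) \<in> S" "T (i, ?j) \<le> k - 1"
    using row_count_iff[OF S T, of i ?j "k - 1"] lt by auto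
  moreover have "k \<le> T (i, ?j + 1)" if "(i, ?j + 1) \<in> S"
    using row_count_iff[OF S T, of i "?j + 1" "k - 1"] that by auto
  moreover have "k \<le> T (i + 1, ?j) - 1" if "(i + 1, ?j) \<in> S"
    using row_count_iff[OF S T, of "i + 1" ?j k] that lt by auto
  ultimately show "u \<in> ?N" using k by (auto simp: u)
qed

text \<open>
  The two index sets are matched through \<open>steps\<close>, leaving the cell in the first row. The contents
  of matched cells differ by \<open>row_count S T (k - 1) i - row_count S T k (i + 1)\<close>, a difference
  that vanishes for the rows outside \<open>steps\<close>. Summed over all rows, and with the content of the
  extra cell in the first row, this leaves \<open>x k\<close> minus the number of cells with entry \<open>k\<close>.
\<close>

lemma skipped_balance:
  fixes x :: "nat \<Rightarrow> int"
  assumes S: "diagram S" and T: "T \<in> tableaux S d" and k: "k \<in> {1..d}"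
  shows "(\<Sum>u\<in>{u \<in> S \<union> outer_corners S. least_entry T u \<le> k \<and> (u \<in> S \<longrightarrow> k < T u)}.
      x k - content u) =
    x k - int (card {u \<in> S. T u \<le> k}) + int (card {u \<in> S. T u \<le> k - 1}) +
    (\<Sum>u\<in>{u \<in> S. T u < k \<and> k \<le> greatest_entry S d T u}. x k - content u)"
proof -
  let ?b = "row_count S T k" and ?a = "row_count S T (k - 1)" and ?I = "steps S d T k"
  have fin: "finite ?I" by (simp add: steps_def)
  have I0: "0 \<notin> ?I" by (auto simp: steps_def)
  have zero: "?b (d + 1) = 0"
    using row_count_iff[OF S T, of "d + 1" "?b (d + 1)" k]
      tableaux_row_le[OF S T, of "d + 1" "?b (d + 1)"] tableaux_le[OF T, of "(d + 1, ?b (d + 1))"]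
    by fastforce
  have "int (card {u \<in> S. T u \<le> k}) = (\<Sum>i\<in>{1..d + 1}. int (?b i))"
    using sum_row_count[OF S T, of k] zero by (simp flip: of_nat_sum)
  also have "\<dots> = int (?b 1) + (\<Sum>i\<in>{1..d}. int (?b (i + 1)))"
    using sum.atLeast_Suc_atMost[of 1 "d + 1" "\<lambda>i. int (?b i)"]
      sum.shift_bounds_cl_Suc_ivl[of "\<lambda>i. int (?b i)" 1 d] by simp
  finally have cb: "int (card {u \<in> S. T u \<le> k}) = int (?b 1) + (\<Sum>i\<in>{1..d}. int (?b (i + 1)))" .
  have ca: "int (card {u \<in> S. T u \<le> k - 1}) = (\<Sum>i\<in>{1..d}. int (?a i))"
    using sum_row_count[OF S T, of "k - 1"] by (simp flip: of_nat_sum)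
  have diff: "(\<Sum>i\<in>{1..d}. int (?a i) - int (?b (i + 1))) = (\<Sum>i\<in>?I. int (?a i) - int (?b (i + 1)))"
  proof (rule sum.mono_neutral_right)
    show "\<forall>i\<in>{1..d} - ?I. int (?a i) - int (?b (i + 1)) = 0"
    proof
      fix i assume "i \<in> {1..d} - ?I"
      then show "int (?a i) - int (?b (i + 1)) = 0"
        using row_count_below[OF S T, of i k] k by (auto simp: steps_def)
    qed
  qed (auto simp: steps_def)
  have "(\<Sum>u\<in>{u \<in> S \<union> outer_corners S. least_entry T u \<le> k \<and> (u \<in> S \<longrightarrow> k < T u)}.
      x k - content u) =
      x k - int (?b 1) + (\<Sum>i\<in>?I. x k - (int (?b (i + 1)) - int i))"
  proof -
    let ?f = "\<lambda>i. (i + 1, ?b (i + 1) + 1)"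
    have "(\<Sum>u\<in>?f ` ?I. x k - content u) = (\<Sum>i\<in>?I. x k - (int (?b (i + 1)) - int i))"
      by (subst sum.reindex, simp add: inj_on_def, rule sum.cong) (simp_all add: content_def)
    moreover have "(1, ?b 1 + 1) \<notin> ?f ` ?I" using I0 by auto
    ultimately show ?thesis
      unfolding skipped_below_entry[OF S T k] using fin by (simp add: content_def)
  qed
  moreover have "(\<Sum>u\<in>{u \<in> S. T u < k \<and> k \<le> greatest_entry S d T u}. x k - content u) =
      (\<Sum>i\<in>?I. x k - (int (?a i) - int i))"
    unfolding skipped_above_entry[OF S T k]
    by (subst sum.reindex) (auto simp: inj_on_def content_def)
  moreover have "(\<Sum>i\<in>?I. x k - (int (?b (i + 1)) - int i)) =
      (\<Sum>i\<in>?I. x k - (int (?a i) - int i)) + (\<Sum>i\<in>?I. int (?a i) - int (?b (i + 1)))"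
    unfolding sum.distrib[symmetric] by (intro sum.cong) simp_all
  ultimately show ?thesis
    using cb ca diff by (simp add: sum_subtractf)
qed

text \<open>
  Exchanging the order of summation reduces this to one value of \<open>k\<close> at a time. The cells with
  entry \<open>k\<close>, for \<open>k\<close> from 1 to \<open>d\<close>, add up to the whole diagram.
\<close>

lemma exponent_balance:
  fixes x :: "nat \<Rightarrow> int"
  assumes S: "diagram S" and T: "T \<in> tableaux S d"
  shows "(\<Sum>u\<in>S. \<Sum>k\<in>{least_entry T u..<T u}. x k - content u) +
      (\<Sum>u\<in>outer_corners S. \<Sum>k\<in>{least_entry T u..d}. x k - content u) =
    (\<Sum>k\<in>{1..d}. x k) - int (card S) +
      (\<Sum>u\<in>S. \<Sum>k\<in>{T u<..greatest_entry S d T u}. x k - content u)"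
proof -
  let ?C = "outer_corners S" and ?c = "\<lambda>k. int (card {u \<in> S. T u \<le> k})"
  have fin: "finite S" "finite ?C" using diagramD(1)[OF S] finite_outer_corners[OF S] by auto
  have disj: "S \<inter> ?C = {}" by (auto simp: outer_corners_def)
  have lo: "1 \<le> least_entry T u" for u by (cases u) auto
  have hi: "greatest_entry S d T u \<le> d" for u
    using tableaux_le[OF T] by (cases u) (auto simp: min_le_iff_disj)
  have sets: "{least_entry T u..<T u} = {k \<in> {1..d}. least_entry T u \<le> k \<and> (u \<in> S \<longrightarrow> k < T u)}"
    if "u \<in> S" for u
    using that lo[of u] tableaux_le[OF T, of u] by (intro set_eqI) (simp, linarith)
  have setc: "{least_entry T u..d} = {k \<in> {1..d}. least_entry T u \<le> k \<and> (u \<in> S \<longrightarrow> k < T u)}"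
    if "u \<in> ?C" for u
    using that lo[of u] disj by auto
  have seth: "{T u<..greatest_entry S d T u} =
      {k \<in> {1..d}. T u < k \<and> k \<le> greatest_entry S d T u}" for u
    using hi[of u] by auto
  have "(\<Sum>u\<in>S. \<Sum>k\<in>{least_entry T u..<T u}. x k - content u) +
      (\<Sum>u\<in>?C. \<Sum>k\<in>{least_entry T u..d}. x k - content u) =
      (\<Sum>u\<in>S \<union> ?C. \<Sum>k\<in>{k \<in> {1..d}. least_entry T u \<le> k \<and> (u \<in> S \<longrightarrow> k < T u)}. x k - content u)"
    using fin disj by (simp add: sum.union_disjoint sets setc cong: sum.cong)
  also have "\<dots> = (\<Sum>k\<in>{1..d}.
      \<Sum>u\<in>{u \<in> S \<union> ?C. least_entry T u \<le> k \<and> (u \<in> S \<longrightarrow> k < T u)}. x k - content u)"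
    using fin by (intro sum.swap_restrict) auto
  also have "\<dots> = (\<Sum>k\<in>{1..d}. x k - ?c k + ?c (k - 1) +
      (\<Sum>u\<in>{u \<in> S. T u < k \<and> k \<le> greatest_entry S d T u}. x k - content u))"
    by (intro sum.cong refl skipped_balance[OF S T])
  also have "\<dots> = (\<Sum>k\<in>{1..d}. x k) - (\<Sum>k\<in>{1..d}. ?c k - ?c (k - 1)) + (\<Sum>k\<in>{1..d}.
      \<Sum>u\<in>{u \<in> S. T u < k \<and> k \<le> greatest_entry S d T u}. x k - content u)"
    by (simp add: sum.distrib sum_subtractf)
  also have "(\<Sum>k\<in>{1..d}. ?c k - ?c (k - 1)) = ?c d - ?c 0"
    by (induction d) auto
  also have "?c d - ?c 0 = int (card S)"
  proof -
    have "{u \<in> S. T u \<le> d} = S" using tableaux_le[OF T] by blast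
    moreover have "{u \<in> S. T u \<le> 0} = {}" using tableaux_pos[OF T] by force
    ultimately show ?thesis by (simp only: card.empty of_nat_0 diff_zero)
  qed
  also have "(\<Sum>k\<in>{1..d}. \<Sum>u\<in>{u \<in> S. T u < k \<and> k \<le> greatest_entry S d T u}. x k - content u) =
      (\<Sum>u\<in>S. \<Sum>k\<in>{k \<in> {1..d}. T u < k \<and> k \<le> greatest_entry S d T u}. x k - content u)"
    using fin by (intro sum.swap_restrict) auto
  finally show ?thesis by (simp only: seth)
qed

lemma prod_power_int:
  fixes q :: "'a::field"
  assumes "q \<noteq> 0"
  shows "(\<Prod>i\<in>A. q powi f i) = q powi (\<Sum>i\<in>A. f i)"
  using assms by (induction A rule: infinite_finite_induct) (auto simp: power_int_add)

lemma wmax_corners_eq_wmin: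
  fixes q :: "'a::field" and x :: "nat \<Rightarrow> int"
  assumes q: "q \<noteq> 0" and S: "diagram S" and T: "T \<in> tableaux S d"
  defines "z \<equiv> \<lambda>u k. q powi (x k - content u)"
  shows "wmax z S T * (\<Prod>a\<in>outer_corners S. \<Prod>k\<in>{least_entry T a..d}. z a k) =
    q powi ((\<Sum>k\<in>{1..d}. x k) - int (card S)) * wmin z S d T"
proof -
  let ?p = "\<Prod>u\<in>S. 1 - z u (T u)"
  have "wmax z S T * (\<Prod>a\<in>outer_corners S. \<Prod>k\<in>{least_entry T a..d}. z a k) =
      ?p * q powi ((\<Sum>u\<in>S. \<Sum>k\<in>{least_entry T u..<T u}. x k - content u) +
        (\<Sum>u\<in>outer_corners S. \<Sum>k\<in>{least_entry T u..d}. x k - content u))"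
    using q by (simp add: wmax_def z_def prod.distrib prod_power_int[OF q] power_int_add mult.assoc)
  also have "\<dots> = q powi ((\<Sum>k\<in>{1..d}. x k) - int (card S)) * wmin z S d T"
    unfolding exponent_balance[OF S T]
    using q by (simp add: wmin_def z_def prod.distrib prod_power_int[OF q] power_int_add mult.left_commute)
  finally show ?thesis .
qed

section \<open>The recurrence for both sides\<close>

lemma alternating_wsum_eq:
  fixes q :: "'a::field" and x :: "nat \<Rightarrow> int"
  assumes q: "q \<noteq> 0" and S: "diagram S"
  defines "z \<equiv> \<lambda>u k. q powi (x k - content u)"
  shows "(\<Sum>A\<in>Pow (outer_corners S). (-1) ^ card A * wsum z d (S \<union> A)) =
    q powi ((\<Sum>k\<in>{1..d}. x k) - int (card S)) * wsum z d S"
proof -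
  let ?c = "q powi ((\<Sum>k\<in>{1..d}. x k) - int (card S))"
  have "(\<Sum>A\<in>Pow (outer_corners S). (-1) ^ card A * wsum z d (S \<union> A)) =
      (\<Sum>T\<in>tableaux S d. ?c * wmin z S d T)"
    unfolding alternating_wsum[OF S]
    using wmax_corners_eq_wmin[OF q S, of _ d x] by (intro sum.cong) (simp_all add: z_def)
  also have "\<dots> = ?c * wsum z d S"
    using sum_wmax_eq_sum_wmin[OF S, of z d] by (simp add: wsum_def flip: sum_distrib_left)
  finally show ?thesis .
qed

lemma finite_rpps:
  assumes "finite S"
  shows "finite {T \<in> rpps S. (\<Sum>u\<in>S. T u) = n}"
proof (rule finite_subset)
  show "{T \<in> rpps S. (\<Sum>u\<in>S. T u) = n} \<subseteq> fillings S (\<lambda>_. {..n})"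
  proof
    fix T assume T: "T \<in> {T \<in> rpps S. (\<Sum>u\<in>S. T u) = n}"
    then have "T u \<le> n" if "u \<in> S" for u
      using member_le_sum[of u S T] that assms by auto
    then show "T \<in> fillings S (\<lambda>_. {..n})"
      using T by (simp add: fillings_def rpps_def)
  qed
  show "finite (fillings S (\<lambda>_. {..n}))"
    using assms by (intro finite_fillings) auto
qed

text \<open>
  Removing some outer corners of \<open>S\<close> from a filling of \<open>L - S\<close> on which it vanishes loses nothing:
  they are minimal in \<open>L - S\<close>, so the value 0 there imposes no condition on the other cells.
\<close>

lemma rpps_Diff_corners:
  assumes S: "diagram S" and L: "diagram L" and A: "A \<subseteq> outer_corners S"
  shows "rpps (L - (S \<union> A)) = {T \<in> rpps (L - S). \<forall>a\<in>A. T a = 0}"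
proof (intro set_eqI iffI)
  fix T assume T: "T \<in> rpps (L - (S \<union> A))"
  have z: "T u = 0" if "u \<notin> L - S \<or> u \<in> A" for u
    using T that unfolding rpps_def by blast
  have notA: "(i, j) \<notin> A" if "(i', j') \<in> L - S" "i' \<le> i" "j' \<le> j" "(i', j') \<noteq> (i, j)" for i j i' j'
  proof
    assume "(i, j) \<in> A"
    then have c: "i = 1 \<or> (i - 1, j) \<in> S" "j = 1 \<or> (i, j - 1) \<in> S"
      using A by (auto simp: outer_corners_def)
    have "1 \<le> i'" "1 \<le> j'" using that(1) diagramD(2,3)[OF L] by auto
    have "(i', j') \<in> S"
    proof (cases "i' = i")
      case True
      then have "j' < j" using that by auto
      then show ?thesis
        using c(2) that(2) \<open>1 \<le> i'\<close> \<open>1 \<le> j'\<close> diagramD(4)[OF S, of i "j - 1" i' j'] by auto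
    next
      case False
      then have "i' < i" using that by auto
      then show ?thesis
        using c(1) that(3) \<open>1 \<le> i'\<close> \<open>1 \<le> j'\<close> diagramD(4)[OF S, of "i - 1" j i' j'] by auto
    qed
    then show False using that(1) by simp
  qed
  have "T (i, j) \<le> T (i, j')" if "(i, j) \<in> L - S" "(i, j') \<in> L - S" "j < j'" for i j j'
    using that T z[of "(i, j)"] notA[of i j i j'] unfolding rpps_def rows_weak_def by fastforce
  moreover have "T (i, j) \<le> T (i', j)" if "(i, j) \<in> L - S" "(i', j) \<in> L - S" "i < i'" for i i' j
    using that T z[of "(i, j)"] notA[of i j i' j] unfolding rpps_def cols_weak_def by fastforce
  ultimately show "T \<in> {T \<in> rpps (L - S). \<forall>a\<in>A. T a = 0}"
    using z by (simp add: rpps_def rows_weak_def cols_weak_def)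
next
  fix T assume T: "T \<in> {T \<in> rpps (L - S). \<forall>a\<in>A. T a = 0}"
  then have "T u = 0" if "u \<notin> L - (S \<union> A)" for u
    using that unfolding rpps_def by (cases "u \<in> A") blast+
  then show "T \<in> rpps (L - (S \<union> A))"
    using T by (simp add: rpps_def rows_weak_def cols_weak_def)
qed

text \<open>
  Walking up or to the left inside \<open>L - S\<close>, along which a filling weakly decreases, ends at an outer
  corner of \<open>S\<close>.
\<close>

lemma rpps_nonzero_if_corners_nonzero:
  assumes S: "diagram S" and L: "diagram L" and T: "T \<in> rpps (L - S)"
    and C: "\<forall>a\<in>outer_corners S \<inter> L. T a \<noteq> 0" and u: "(i, j) \<in> L - S"
  shows "T (i, j) \<noteq> 0"
  using u
proof (induction "i + j" arbitrary: i j rule: less_induct)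
  case less
  have ge: "1 \<le> i" "1 \<le> j" using less.prems diagramD(2,3)[OF L] by auto
  show ?case
  proof (cases "(i, j) \<in> outer_corners S")
    case True
    then show ?thesis using C less.prems by blast
  next
    case False
    then consider "i \<noteq> 1" "(i - 1, j) \<notin> S" | "j \<noteq> 1" "(i, j - 1) \<notin> S"
      using less.prems ge by (auto simp: outer_corners_def)
    then show ?thesis
    proof cases
      case 1
      then have m: "(i - 1, j) \<in> L - S"
        using diagramD(4)[OF L, of i j "i - 1" j] less.prems ge by simp
      then have "T (i - 1, j) \<noteq> 0" using less.hyps[of "i - 1" j] ge 1 by simp
      moreover have "T (i - 1, j) \<le> T (i, j)"
      proof -
        have "i - 1 < i" using ge by simp
        then show ?thesis using T m less.prems unfolding rpps_def cols_weak_def by blast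
      qed
      ultimately show ?thesis by simp
    next
      case 2
      then have m: "(i, j - 1) \<in> L - S"
        using diagramD(4)[OF L, of i j i "j - 1"] less.prems ge by simp
      then have "T (i, j - 1) \<noteq> 0" using less.hyps[of i "j - 1"] ge 2 by simp
      moreover have "T (i, j - 1) \<le> T (i, j)"
      proof -
        have "j - 1 < j" using ge by simp
        then show ?thesis using T m less.prems unfolding rpps_def rows_weak_def by blast
      qed
      ultimately show ?thesis by simp
    qed
  qed
qed

lemma card_rpps_nonzero:
  assumes "finite D"
  shows "card {T \<in> rpps D. (\<Sum>u\<in>D. T u) = n \<and> (\<forall>u\<in>D. T u \<noteq> 0)} =
    (if n < card D then 0 else card {T \<in> rpps D. (\<Sum>u\<in>D. T u) = n - card D})"
proof -
  have sum_Suc: "(\<Sum>u\<in>D. T u + 1) = (\<Sum>u\<in>D. T u) + card D" for T :: "cell \<Rightarrow> nat"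
    unfolding sum.distrib by simp
  show ?thesis
  proof (cases "n < card D")
    case True
    have "(\<Sum>u\<in>D. T u) \<noteq> n" if "\<forall>u\<in>D. T u \<noteq> 0" for T
    proof -
      have "(\<Sum>u\<in>D. 1) \<le> (\<Sum>u\<in>D. T u)" using that by (intro sum_mono) (simp add: Suc_leI)
      then show ?thesis using True by simp
    qed
    then have "{T \<in> rpps D. (\<Sum>u\<in>D. T u) = n \<and> (\<forall>u\<in>D. T u \<noteq> 0)} = {}" by blast
    with True show ?thesis by (simp only: card.empty if_True)
  next
    case False
    have "bij_betw (\<lambda>T u. if u \<in> D then T u + 1 else 0)
        {T \<in> rpps D. (\<Sum>u\<in>D. T u) = n - card D}
        {T \<in> rpps D. (\<Sum>u\<in>D. T u) = n \<and> (\<forall>u\<in>D. T u \<noteq> 0)}"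
    proof (rule bij_betwI[where g = "\<lambda>T u. T u - 1"])
      show "(\<lambda>T u. if u \<in> D then T u + 1 else 0) \<in> {T \<in> rpps D. (\<Sum>u\<in>D. T u) = n - card D} \<rightarrow>
          {T \<in> rpps D. (\<Sum>u\<in>D. T u) = n \<and> (\<forall>u\<in>D. T u \<noteq> 0)}"
      proof
        fix T assume T: "T \<in> {T \<in> rpps D. (\<Sum>u\<in>D. T u) = n - card D}"
        then have "(\<Sum>u\<in>D. if u \<in> D then T u + 1 else 0) = n"
          using sum_Suc[of T] False by simp
        then show "(\<lambda>u. if u \<in> D then T u + 1 else 0) \<in>
            {T \<in> rpps D. (\<Sum>u\<in>D. T u) = n \<and> (\<forall>u\<in>D. T u \<noteq> 0)}"
          using T by (simp add: rpps_def rows_weak_def cols_weak_def)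
      qed
      show "(\<lambda>T u. T u - 1) \<in> {T \<in> rpps D. (\<Sum>u\<in>D. T u) = n \<and> (\<forall>u\<in>D. T u \<noteq> 0)} \<rightarrow>
          {T \<in> rpps D. (\<Sum>u\<in>D. T u) = n - card D}"
      proof
        fix T assume T: "T \<in> {T \<in> rpps D. (\<Sum>u\<in>D. T u) = n \<and> (\<forall>u\<in>D. T u \<noteq> 0)}"
        have "(\<Sum>u\<in>D. T u - 1 + 1) = (\<Sum>u\<in>D. T u)"
          using T by (intro sum.cong) auto
        then have "(\<Sum>u\<in>D. T u - 1) = n - card D"
          using sum_Suc[of "\<lambda>u. T u - 1"] T by auto
        moreover have "(\<lambda>u. T u - 1) \<in> rpps D"
          using T by (simp add: rpps_def rows_weak_def cols_weak_def diff_le_mono)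
        ultimately show "(\<lambda>u. T u - 1) \<in> {T \<in> rpps D. (\<Sum>u\<in>D. T u) = n - card D}" by blast
      qed
    next
      fix T assume T: "T \<in> {T \<in> rpps D. (\<Sum>u\<in>D. T u) = n - card D}"
      have "T u = 0" if "u \<notin> D" for u using T that unfolding rpps_def by blast
      then show "(\<lambda>u. (if u \<in> D then T u + 1 else 0) - 1) = T" by (intro ext) simp
    next
      fix T assume T: "T \<in> {T \<in> rpps D. (\<Sum>u\<in>D. T u) = n \<and> (\<forall>u\<in>D. T u \<noteq> 0)}"
      have "T u = 0" if "u \<notin> D" for u using T that unfolding rpps_def by blast
      moreover have "T u \<noteq> 0" if "u \<in> D" for u using T that by blast
      ultimately show "(\<lambda>u. if u \<in> D then T u - 1 + 1 else 0) = T" by (intro ext) simp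
    qed
    with False show ?thesis using bij_betw_same_card by fastforce
  qed
qed

text \<open>
  By inclusion and exclusion over the corners with entry 0, the left-hand side counts the fillings
  that vanish at no corner. These vanish nowhere, and subtracting 1 from every entry turns them
  into arbitrary fillings, at the cost of one power of the variable for each cell.
\<close>

lemma alternating_rpp_gf:
  assumes S: "diagram S" and L: "diagram L"
  defines "C \<equiv> outer_corners S \<inter> L"
  shows "(\<Sum>A\<in>Pow C. (-1) ^ card A * rpp_gf (L - (S \<union> A))) =
    fps_X ^ card (L - S) * rpp_gf (L - S)"
proof (rule fps_ext)
  fix n
  let ?D = "L - S"
  let ?R = "{T \<in> rpps ?D. (\<Sum>u\<in>?D. T u) = n}"
  have finD: "finite ?D" using diagramD(1)[OF L] by simp
  have finR: "finite ?R" by (rule finite_rpps[OF finD])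
  have finC: "finite C" using finite_outer_corners[OF S] by (simp add: C_def)
  have coeff: "rpp_gf (L - (S \<union> A)) $ n = (\<Sum>T\<in>?R. \<Prod>a\<in>A. of_bool (T a = 0))" if A: "A \<subseteq> C" for A
  proof -
    have finA: "finite A" using A finC finite_subset by blast
    have "{T \<in> rpps (L - (S \<union> A)). (\<Sum>u\<in>L - (S \<union> A). T u) = n} = {T \<in> ?R. \<forall>a\<in>A. T a = 0}"
    proof -
      have "(\<Sum>u\<in>L - (S \<union> A). T u) = (\<Sum>u\<in>?D. T u)" if "\<forall>a\<in>A. T a = 0" for T :: "cell \<Rightarrow> nat"
        using that finD by (intro sum.mono_neutral_left) auto
      then show ?thesis
        using A by (auto simp: rpps_Diff_corners[OF S L, of A] C_def)
    qed
    moreover have "(\<Prod>a\<in>A. of_bool (T a = 0)) = (of_bool (\<forall>a\<in>A. T a = 0) :: rat)"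
      for T :: "cell \<Rightarrow> nat"
      using finA by (induction A rule: finite_induct) auto
    ultimately show ?thesis
      using finR by (simp add: rpp_gf_def Int_def conj_assoc)
  qed
  have "(\<Sum>A\<in>Pow C. (-1) ^ card A * rpp_gf (L - (S \<union> A))) $ n =
      (\<Sum>A\<in>Pow C. (-1) ^ card A * rpp_gf (L - (S \<union> A)) $ n)"
    unfolding fps_sum_nth by (intro sum.cong refl) (simp add: minus_one_power_iff)
  also have "\<dots> = (\<Sum>A\<in>Pow C. \<Sum>T\<in>?R. (-1) ^ card A * (\<Prod>a\<in>A. of_bool (T a = 0)))"
    by (intro sum.cong refl) (simp add: coeff sum_distrib_left)
  also have "\<dots> = (\<Sum>T\<in>?R. \<Sum>A\<in>Pow C. (-1) ^ card A * (\<Prod>a\<in>A. of_bool (T a = 0)))"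
    by (rule sum.swap)
  also have "\<dots> = (\<Sum>T\<in>?R. \<Prod>a\<in>C. 1 - of_bool (T a = 0))"
    using prod_diff_conv_sum[OF finC, where ?f1.0 = "\<lambda>_. 1 :: rat"]
    by (intro sum.cong refl) simp
  also have "\<dots> = (\<Sum>T\<in>?R. of_bool (\<forall>u\<in>?D. T u \<noteq> 0))"
  proof (intro sum.cong refl)
    fix T assume "T \<in> ?R"
    then have "(\<forall>a\<in>C. T a \<noteq> 0) \<longleftrightarrow> (\<forall>u\<in>?D. T u \<noteq> 0)"
      using rpps_nonzero_if_corners_nonzero[OF S L, of T]
      by (auto simp: C_def outer_corners_def)
    moreover have "(\<Prod>a\<in>C. 1 - of_bool (T a = 0)) = (of_bool (\<forall>a\<in>C. T a \<noteq> 0) :: rat)"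
      using finC by (induction C rule: finite_induct) auto
    ultimately show "(\<Prod>a\<in>C. 1 - of_bool (T a = 0)) = (of_bool (\<forall>u\<in>?D. T u \<noteq> 0) :: rat)"
      by simp
  qed
  also have "\<dots> = of_nat (card {T \<in> ?R. \<forall>u\<in>?D. T u \<noteq> 0})"
    using finR by (simp add: Int_def conj_assoc)
  also have "\<dots> = (fps_X ^ card ?D * rpp_gf ?D) $ n"
    using card_rpps_nonzero[OF finD, of n]
    by (simp add: fps_X_power_mult_nth rpp_gf_def conj_assoc)
  finally show "(\<Sum>A\<in>Pow C. (-1) ^ card A * rpp_gf (L - (S \<union> A))) $ n =
      (fps_X ^ card ?D * rpp_gf ?D) $ n" .
qed

section \<open>The recurrence determines the generating function\<close>

text \<open>
  The term for \<open>A = {}\<close> can be moved to the right-hand side, where it leaves the factor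
  \<open>q ^ card (L - S) - 1\<close>. As this is nonzero unless \<open>S = L\<close>, the value at \<open>S\<close> is determined by the
  values at larger diagrams, and a solution is determined by its value at \<open>L\<close>.
\<close>

lemma alternating_recurrence_unique:
  fixes q :: "'a::field"
  assumes q: "\<And>n. 0 < n \<Longrightarrow> q ^ n \<noteq> 1" and L: "diagram L"
    and F: "\<And>S. diagram S \<Longrightarrow> S \<subseteq> L \<Longrightarrow>
      (\<Sum>A\<in>Pow (outer_corners S \<inter> L). (-1) ^ card A * F (S \<union> A)) = q ^ card (L - S) * F S"
    and G: "\<And>S. diagram S \<Longrightarrow> S \<subseteq> L \<Longrightarrow>
      (\<Sum>A\<in>Pow (outer_corners S \<inter> L). (-1) ^ card A * G (S \<union> A)) = q ^ card (L - S) * G S"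
    and S: "diagram S" "S \<subseteq> L"
  shows "F S * G L = F L * G S"
  using S
proof (induction "card (L - S)" arbitrary: S rule: less_induct)
  case less
  let ?C = "outer_corners S \<inter> L" and ?N = "card (L - S)"
  have finL: "finite (L - S)" using diagramD(1)[OF L] by simp
  show ?case
  proof (cases "S = L")
    case False
    then have N: "0 < ?N" using less.prems finL by (auto simp: card_gt_0_iff)
    have finC: "finite (Pow ?C)" using finite_outer_corners[OF less.prems(1)] by simp
    have split: "(\<Sum>A\<in>Pow ?C - {{}}. (-1) ^ card A * H (S \<union> A)) = (q ^ ?N - 1) * H S"
      if "(\<Sum>A\<in>Pow ?C. (-1) ^ card A * H (S \<union> A)) = q ^ ?N * H S" for H :: "cell set \<Rightarrow> 'a"
      using that sum.remove[OF finC, of "{}" "\<lambda>A. (-1) ^ card A * H (S \<union> A)"]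
      by (simp add: algebra_simps)
    have IH: "F (S \<union> A) * G L = F L * G (S \<union> A)" if A: "A \<in> Pow ?C - {{}}" for A
    proof (rule less.hyps)
      have "A \<inter> S = {}" using A by (auto simp: outer_corners_def)
      then have "L - (S \<union> A) \<subset> L - S" using A by auto
      then show "card (L - (S \<union> A)) < card (L - S)" by (rule psubset_card_mono[OF finL])
      show "diagram (S \<union> A)" using A diagram_Un_outer_corners[OF less.prems(1)] by blast
      show "S \<union> A \<subseteq> L" using A less.prems(2) by blast
    qed
    have "(q ^ ?N - 1) * (F S * G L) = (\<Sum>A\<in>Pow ?C - {{}}. (-1) ^ card A * F (S \<union> A)) * G L"
      unfolding split[OF F[OF less.prems]] by simp
    also have "\<dots> = (\<Sum>A\<in>Pow ?C - {{}}. (-1) ^ card A * (F L * G (S \<union> A)))"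
      unfolding sum_distrib_right by (intro sum.cong refl) (simp add: IH mult.assoc)
    also have "\<dots> = F L * (\<Sum>A\<in>Pow ?C - {{}}. (-1) ^ card A * G (S \<union> A))"
      unfolding sum_distrib_left by (intro sum.cong refl) (rule mult.left_commute)
    also have "\<dots> = (q ^ ?N - 1) * (F L * G S)"
      unfolding split[OF G[OF less.prems]] by simp
    finally show ?thesis using q[OF N] by simp
  qed simp
qed

section \<open>Weights coming from a partition\<close>

lemma part_pos: "is_partition lam \<Longrightarrow> 1 \<le> i \<Longrightarrow> i \<le> length lam \<Longrightarrow> 1 \<le> part lam i"
proof -
  assume a: "is_partition lam" "1 \<le> i" "i \<le> length lam"
  then have "lam ! (i - 1) \<in> set lam" by simp
  then have "lam ! (i - 1) \<noteq> 0" using a(1) unfolding is_partition_def by metis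
  then show ?thesis using a(2,3) by (simp add: part_def)
qed

lemma part_antimono: "is_partition lam \<Longrightarrow> 1 \<le> i \<Longrightarrow> i \<le> i' \<Longrightarrow> part lam i' \<le> part lam i"
  by (cases "i = i'") (auto simp: is_partition_def part_def sorted_wrt_iff_nth_less)

lemma mem_young: "(i, j) \<in> young lam \<longleftrightarrow> 1 \<le> i \<and> 1 \<le> j \<and> j \<le> part lam i"
  by (auto simp: young_def part_def)

lemma young_eq_Sigma: "young lam = Sigma {1..length lam} (\<lambda>i. {1..part lam i})"
  by (auto simp: young_def)

lemma diagram_young:
  assumes "is_partition lam"
  shows "diagram (young lam)"
  unfolding diagram_def
proof (intro conjI allI impI)
  show "finite (young lam)" by (simp add: young_eq_Sigma)
  fix i j i' j' assume "(i, j) \<in> young lam \<and> 1 \<le> i' \<and> i' \<le> i \<and> 1 \<le> j' \<and> j' \<le> j"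
  then show "(i', j') \<in> young lam"
    using part_antimono[OF assms, of i' i] by (auto simp: mem_young)
qed (auto simp: mem_young)

text \<open>
  The weight of the position that \<open>u\<close> occupies after it has been moved to row \<open>k\<close>.
\<close>

definition box_weight :: "nat list \<Rightarrow> cell \<Rightarrow> nat \<Rightarrow> int" where
  "box_weight lam u k = int (part lam (length lam + 1 - k)) - content u"

text \<open>
  Going up in a column increases the content and decreases the entry, so the weight in the first
  row is nonpositive, too. Along the first row, the weight starts with a part of the partition,
  which is positive, and drops by at most 1 at each step. Hence it takes the value 0.
\<close>

lemma exists_zero_box_weight:
  assumes lam: "is_partition lam" and S: "diagram S" and T: "T \<in> tableaux S (length lam)"
    and u: "(i, j) \<in> S" "box_weight lam (i, j) (T (i, j)) \<le> 0"
  shows "\<exists>v\<in>S. box_weight lam v (T v) = 0"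
proof -
  let ?x = "\<lambda>k. int (part lam (length lam + 1 - k))"
  have mono: "?x k \<le> ?x k'" if "k \<le> k'" "k' \<le> length lam" for k k'
    using part_antimono[OF lam, of "length lam + 1 - k'" "length lam + 1 - k"] that by simp
  define f where "f = (\<lambda>j. box_weight lam (1, j) (T (1, j)))"
  have ge: "1 \<le> i" "1 \<le> j" using diagramD(2,3)[OF S u(1)] by auto
  have row: "(1, j') \<in> S" if "1 \<le> j'" "j' \<le> j" for j'
    using diagramD(4)[OF S u(1), of 1 j'] that ge by simp
  have "T (1, j) \<le> T (i, j)"
    using tableaux_col_mono[OF T u(1) row] ge by (cases "i = 1") auto
  then have fj: "f j \<le> 0"
    using u(2) mono[of "T (1, j)" "T (i, j)"] tableaux_le[OF T] ge
    by (force simp: f_def box_weight_def content_def)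
  define m where "m = (LEAST m. 1 \<le> m \<and> f m \<le> 0)"
  have m: "1 \<le> m" "f m \<le> 0" "m \<le> j"
    using LeastI[of "\<lambda>m. 1 \<le> m \<and> f m \<le> 0" j] Least_le[of "\<lambda>m. 1 \<le> m \<and> f m \<le> 0" j] fj ge
    by (auto simp: m_def)
  have "m \<noteq> 1"
  proof
    assume "m = 1"
    then have "?x (T (1, 1)) \<le> 0" using m by (simp add: f_def box_weight_def content_def)
    moreover have "1 \<le> length lam + 1 - T (1, 1)" "length lam + 1 - T (1, 1) \<le> length lam"
      using tableaux_le[OF T, of "(1, 1)"] tableaux_pos[OF T row[of 1]] ge by simp_all
    ultimately show False using part_pos[OF lam, of "length lam + 1 - T (1, 1)"] by simp
  qed
  then have m1: "1 \<le> m - 1" "m - 1 < m" using m by auto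
  then have "\<not> f (m - 1) \<le> 0"
    using not_less_Least[of "m - 1" "\<lambda>m. 1 \<le> m \<and> f m \<le> 0"] by (simp add: m_def)
  moreover have "?x (T (1, m - 1)) \<le> ?x (T (1, m))"
    using tableaux_row_mono[OF T row[of m] row[of "m - 1"]] tableaux_le[OF T] m m1
    by (intro mono) auto
  ultimately have "f m = 0" using m m1 by (auto simp: f_def box_weight_def content_def)
  then show ?thesis using row[of m] m by (auto simp: f_def)
qed

lemma tableaux_col_growth:
  assumes S: "diagram S" and T: "T \<in> tableaux S d" and u: "(i, j) \<in> S"
  shows "T (1, j) + i \<le> T (i, j) + 1"
  using u
proof (induction i)
  case (Suc i)
  show ?case
  proof (cases "i = 0")
    case False
    then have "(i, j) \<in> S"
      using diagramD(4)[OF S Suc.prems, of i j] diagramD(3)[OF S Suc.prems] by simp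
    then show ?thesis
      using Suc.IH tableaux_col_mono[OF T Suc.prems, of i] by simp
  qed simp
qed (use diagramD(2)[OF S] in force)

lemma wmax_eq_0:
  fixes q :: "'a::field"
  assumes "finite S" "v \<in> S" "box_weight lam v (T v) = 0"
  shows "wmax (\<lambda>u k. q powi box_weight lam u k) S T = 0"
  unfolding wmax_def using assms by (intro prod_zero) (auto intro!: bexI[of _ v])

text \<open>
  If \<open>(i, j)\<close> lies outside the partition, the strict increase in column \<open>j\<close> forces its top entry
  to be at most \<open>length lam + 1 - i\<close>. This makes the weight of the top cell nonpositive.
\<close>

lemma wsum_eq_0:
  fixes q :: "'a::field"
  assumes lam: "is_partition lam" and S: "diagram S" and nle: "\<not> S \<subseteq> young lam"
  shows "wsum (\<lambda>u k. q powi box_weight lam u k) (length lam) S = 0"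
  unfolding wsum_def
proof (rule sum.neutral, rule ballI)
  fix T assume T: "T \<in> tableaux S (length lam)"
  obtain i j where u: "(i, j) \<in> S" "(i, j) \<notin> young lam" using nle by auto
  have ge: "1 \<le> i" "1 \<le> j" using diagramD(2,3)[OF S u(1)] by auto
  have u1: "(1, j) \<in> S" using diagramD(4)[OF S u(1), of 1 j] ge by simp
  have "T (1, j) + i \<le> length lam + 1"
    using tableaux_col_growth[OF S T u(1)] tableaux_le[OF T, of "(i, j)"] by simp
  then have "part lam (length lam + 1 - T (1, j)) \<le> part lam i"
    using ge by (intro part_antimono[OF lam]) auto
  also have "part lam i < j" using u(2) ge by (simp add: mem_young)
  finally have "box_weight lam (1, j) (T (1, j)) \<le> 0"
    by (simp add: box_weight_def content_def)
  then obtain v where "v \<in> S" "box_weight lam v (T v) = 0"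
    using exists_zero_box_weight[OF lam S T u1] by blast
  then show "wmax (\<lambda>u k. q powi box_weight lam u k) S T = 0"
    by (rule wmax_eq_0[OF diagramD(1)[OF S]])
qed

text \<open>
  The general recurrence runs over all outer corners, but corners outside of the partition lead to
  diagrams with a vanishing sum.
\<close>

lemma alternating_wsum_partition:
  fixes q :: "'a::field"
  assumes q: "q \<noteq> 0" and lam: "is_partition lam" and S: "diagram S" "S \<subseteq> young lam"
  defines "F \<equiv> wsum (\<lambda>u k. q powi box_weight lam u k) (length lam)"
  shows "(\<Sum>A\<in>Pow (outer_corners S \<inter> young lam). (-1) ^ card A * F (S \<union> A)) =
    q ^ card (young lam - S) * F S"
proof -
  let ?L = "young lam" and ?d = "length lam"
  have finL: "finite ?L" using diagramD(1)[OF diagram_young[OF lam]] .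
  have "(\<Sum>A\<in>Pow (outer_corners S \<inter> ?L). (-1) ^ card A * F (S \<union> A)) =
      (\<Sum>A\<in>Pow (outer_corners S). (-1) ^ card A * F (S \<union> A))"
  proof (rule sum.mono_neutral_left)
    show "\<forall>A\<in>Pow (outer_corners S) - Pow (outer_corners S \<inter> ?L). (-1) ^ card A * F (S \<union> A) = 0"
    proof
      fix A assume A: "A \<in> Pow (outer_corners S) - Pow (outer_corners S \<inter> ?L)"
      then have "F (S \<union> A) = 0"
        unfolding F_def using diagram_Un_outer_corners[OF S(1)] by (intro wsum_eq_0[OF lam]) auto
      then show "(-1) ^ card A * F (S \<union> A) = 0" by simp
    qed
  qed (use finite_outer_corners[OF S(1)] in auto)
  also have "\<dots> = q powi ((\<Sum>k\<in>{1..?d}. int (part lam (?d + 1 - k))) - int (card S)) * F S"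
    using alternating_wsum_eq[OF q S(1), where x = "\<lambda>k. int (part lam (?d + 1 - k))"]
    by (simp add: F_def box_weight_def)
  also have "(\<Sum>k\<in>{1..?d}. int (part lam (?d + 1 - k))) = int (card ?L)"
    using sum.atLeastAtMost_rev[of "\<lambda>i. int (part lam i)" 1 ?d]
    by (simp add: young_eq_Sigma)
  also have "int (card ?L) - int (card S) = int (card (?L - S))"
    using S finL card_mono[of ?L S] by (simp add: card_Diff_subset of_nat_diff diagramD(1))
  finally show ?thesis by simp
qed

lemma wsum_empty: "wsum z d {} = 1"
proof -
  have "tableaux {} d = {\<lambda>_. 0}"
    by (auto simp: tableaux_def rows_weak_def cols_strict_def)
  then show ?thesis by (simp add: wsum_def wmax_def)
qed

lemma rpp_gf_empty: "rpp_gf {} = 1"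
proof -
  have "rpps {} = {\<lambda>_. 0}"
    by (auto simp: rpps_def rows_weak_def cols_weak_def)
  then show ?thesis
    by (intro fps_ext) (auto simp: rpp_gf_def fps_one_nth Collect_conv_if)
qed

text \<open>
  Both sides, up to the denominator, solve the same recurrence, hence they are proportional. The
  factor is found at the empty diagram, where \<open>wsum\<close> is 1.
\<close>

lemma rpp_gf_quotient:
  assumes lam: "is_partition lam" and S: "diagram S" "S \<subseteq> young lam"
  shows "fps_to_fls (rpp_gf (young lam - S)) / fps_to_fls (rpp_gf (young lam)) =
    wsum (\<lambda>u k. fls_X powi box_weight lam u k) (length lam) S"
proof -
  let ?L = "young lam"
  have L: "diagram ?L" by (rule diagram_young[OF lam])
  define q :: "rat fls" where "q = fls_X"
  define F where "F = wsum (\<lambda>u k. q powi box_weight lam u k) (length lam)"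
  define G where "G = (\<lambda>S. fps_to_fls (rpp_gf (?L - S)))"
  have q0: "q \<noteq> 0" by (simp add: q_def)
  have q1: "q ^ n \<noteq> 1" if "0 < n" for n
  proof
    assume "q ^ n = 1"
    then have "fls_nth (q ^ n) 0 = fls_nth (1 :: rat fls) 0" by simp
    then show False using that by (simp add: q_def)
  qed
  have F: "(\<Sum>A\<in>Pow (outer_corners R \<inter> ?L). (-1) ^ card A * F (R \<union> A)) =
      q ^ card (?L - R) * F R" if "diagram R" "R \<subseteq> ?L" for R
    unfolding F_def by (rule alternating_wsum_partition[OF q0 lam that])
  have G: "(\<Sum>A\<in>Pow (outer_corners R \<inter> ?L). (-1) ^ card A * G (R \<union> A)) =
      q ^ card (?L - R) * G R" if "diagram R" "R \<subseteq> ?L" for R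
  proof -
    have hom: "fps_to_fls (\<Sum>A\<in>X. f A) = (\<Sum>A\<in>X. fps_to_fls (f A))"
      for X :: "cell set set" and f :: "cell set \<Rightarrow> rat fps"
      by (induction X rule: infinite_finite_induct) auto
    have "fps_to_fls (\<Sum>A\<in>Pow (outer_corners R \<inter> ?L). (-1) ^ card A * rpp_gf (?L - (R \<union> A))) =
        (\<Sum>A\<in>Pow (outer_corners R \<inter> ?L). (-1) ^ card A * G (R \<union> A))"
      by (simp add: G_def hom fls_times_fps_to_fls fps_to_fls_power minus_one_power_iff
          if_distrib[of fps_to_fls] cong: if_cong)
    then show ?thesis
      unfolding alternating_rpp_gf[OF that(1) L]
      by (simp add: G_def q_def fls_times_fps_to_fls fps_to_fls_power)
  qed
  have ratio: "F R * G ?L = F ?L * G R" if "diagram R" "R \<subseteq> ?L" for R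
    using q1 by (rule alternating_recurrence_unique[OF _ L F G that])
  have GL: "G ?L = 1" by (simp add: G_def rpp_gf_empty)
  have "diagram {}" by (simp add: diagram_def)
  then have "F ?L * G {} = 1" using ratio[of "{}"] GL by (simp add: F_def wsum_empty)
  moreover from this have "G {} \<noteq> 0" by auto
  ultimately have "F ?L = 1 / G {}" by (simp add: eq_divide_eq)
  then have "F S = G S / G {}" using ratio[OF S] GL by simp
  then show ?thesis by (simp add: F_def G_def q_def)
qed

section \<open>Excited diagrams and their peaks\<close>

lemma tableaux_mono:
  assumes S: "diagram S" and T: "T \<in> tableaux S d" and u: "(i, j) \<in> S"
    and le: "1 \<le> i'" "i' \<le> i" "1 \<le> j'" "j' \<le> j"
  shows "T (i', j') \<le> T (i, j)" and "i' < i \<Longrightarrow> T (i', j') < T (i, j)"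
proof -
  have m: "(i', j) \<in> S" "(i', j') \<in> S"
    using diagramD(4)[OF S u, of i' j] diagramD(4)[OF S u, of i' j'] le by auto
  have 1: "T (i', j') \<le> T (i', j)" using tableaux_row_mono[OF T m(1,2)] le by simp
  show 2: "T (i', j') < T (i, j)" if "i' < i"
    using 1 tableaux_col_mono[OF T u m(1) that] by simp
  show "T (i', j') \<le> T (i, j)" using 1 2 le(2) by (cases "i' = i") auto
qed

text \<open>
  The excited diagram of a tableau, with the condition that the cell \<open>(a, b)\<close> stays on its diagonal
  stated as an equation of natural numbers.
\<close>

definition moved_cells :: "cell set \<Rightarrow> (cell \<Rightarrow> nat) \<Rightarrow> cell set" where
  "moved_cells S T = {(x, y). \<exists>a b. (a, b) \<in> S \<and> x = T (a, b) \<and> y + a = x + b}"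

text \<open>
  The cell \<open>(a, b)\<close> has left row \<open>x\<close> if \<open>a \<le> x\<close> and \<open>x < T (a, b)\<close>. The peak created by this move is destroyed
  by later moves of the cell to the left out of row \<open>x\<close> and of the cell above out of row
  \<open>x - 1\<close>. It survives if neither of these cells has gone that far, which is the
  condition \<open>least_entry T (a, b) \<le> x\<close>.
\<close>

definition peak_cells :: "cell set \<Rightarrow> (cell \<Rightarrow> nat) \<Rightarrow> cell set" where
  "peak_cells S T = {(x, y). \<exists>a b. (a, b) \<in> S \<and>
     least_entry T (a, b) \<le> x \<and> x < T (a, b) \<and> y + a = x + b}"

lemma moved_cellsI: "(a, b) \<in> S \<Longrightarrow> x = T (a, b) \<Longrightarrow> y + a = x + b \<Longrightarrow> (x, y) \<in> moved_cells S T"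
  unfolding moved_cells_def by blast

lemma tableau_diagram_eq_moved_cells:
  assumes mu: "is_partition mu" and T: "T \<in> tableaux (young mu) d"
  shows "tableau_diagram mu T = moved_cells (young mu) T"
proof (intro set_eqI iffI)
  fix u assume "u \<in> tableau_diagram mu T"
  then obtain a b where u: "(a, b) \<in> young mu"
    "u = (T (a, b), nat (int (T (a, b)) + content (a, b)))"
    by (auto simp: tableau_diagram_def)
  then have "nat (int (T (a, b)) + content (a, b)) + a = T (a, b) + b"
    using tableaux_row_le[OF diagram_young[OF mu] T u(1)] by (simp add: content_def)
  then show "u \<in> moved_cells (young mu) T" using u by (auto simp: moved_cells_def)
next
  fix u assume "u \<in> moved_cells (young mu) T"
  then obtain a b y where u: "(a, b) \<in> young mu" "u = (T (a, b), y)" "y + a = T (a, b) + b"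
    by (auto simp: moved_cells_def)
  then have "int y = int (T (a, b)) + content (a, b)" by (simp add: content_def)
  then have "y = nat (int (T (a, b)) + content (a, b))" by (metis nat_int)
  then show "u \<in> tableau_diagram mu T"
    unfolding tableau_diagram_def using u by (intro image_eqI[of _ _ "(a, b)"]) auto
qed

text \<open>
  On each diagonal the entries strictly increase, so a tableau lists the rows of the diagram's cells
  in increasing order. In a first place where two tableaux with the same diagram differ, the
  smaller entry would be missing from the other one.
\<close>

lemma moved_cells_inj:
  assumes S: "diagram S" and T: "T \<in> tableaux S d" and T': "T' \<in> tableaux S d"
    and eq: "moved_cells S T = moved_cells S T'"
  shows "T = T'"
proof -
  have *: "T (i, j) \<ge> T' (i, j)"
    if T: "T \<in> tableaux S d" and T': "T' \<in> tableaux S d" and eq: "moved_cells S T = moved_cells S T'"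
      and u: "(i, j) \<in> S"
      and IH: "\<And>i' j'. (i', j') \<in> S \<Longrightarrow> i' < i \<Longrightarrow> T (i', j') = T' (i', j')" for T T' i j
  proof (rule ccontr)
    assume lt: "\<not> T (i, j) \<ge> T' (i, j)"
    have ge: "i \<le> T (i, j)" by (rule tableaux_row_le[OF S T u])
    then have "(T (i, j), T (i, j) + j - i) \<in> moved_cells S T'"
      unfolding eq[symmetric] by (intro moved_cellsI[OF u]) auto
    then obtain a b where ab: "(a, b) \<in> S" "T (i, j) = T' (a, b)" "a + j = i + b"
      using ge by (auto simp: moved_cells_def)
    have "1 \<le> i" "1 \<le> j" using diagramD(2,3)[OF S u] by auto
    then have "a < i"
      using tableaux_mono(1)[OF S T' ab(1), of i j] ab lt by linarith
    then have "T (a, b) = T (i, j)" using IH[OF ab(1)] ab(2) by simp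
    moreover have "T (a, b) < T (i, j)"
      using tableaux_mono(2)[OF S T u, of a b] ab \<open>a < i\<close> diagramD(2,3)[OF S ab(1)] by simp
    ultimately show False by simp
  qed
  have "T (i, j) = T' (i, j)" if "(i, j) \<in> S" for i j
    using that
  proof (induction i arbitrary: j rule: less_induct)
    case (less i)
    show ?case
      using *[OF T T' eq less.prems] *[OF T' T eq[symmetric] less.prems] less.IH by fastforce
  qed
  then show ?thesis
    using tableaux_zero[OF T] tableaux_zero[OF T'] by (intro ext) (metis prod.exhaust)
qed

text \<open>
  If increasing one entry by 1 gives a tableau again, then the neighbours to the right of and below
  that cell are far enough ahead. The other cells on the three diagonals involved lie
  further up, where entries are too small to get in the way, or further down, where they are too
  large.
\<close>

lemma moved_cells_move:
  assumes S: "diagram S" and T: "T \<in> tableaux S d" and u: "(a, b) \<in> S"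
    and T': "T((a, b) := T (a, b) + 1) \<in> tableaux S d" and ij: "i = T (a, b)" "j + a = i + b"
  shows "excited_move d (i, j) (moved_cells S T) (moved_cells S (T((a, b) := T (a, b) + 1)))"
proof -
  let ?T' = "T((a, b) := T (a, b) + 1)"
  have ge: "1 \<le> a" "1 \<le> b" "a \<le> i"
    using diagramD(2,3)[OF S u] tableaux_row_le[OF S T u] ij by auto
  have right: "i + 1 \<le> T (a, b + 1)" if "(a, b + 1) \<in> S"
    using tableaux_mono(1)[OF S T' that, of a b] ge ij by simp
  have below: "i + 1 < T (a + 1, b)" if "(a + 1, b) \<in> S"
    using tableaux_mono(2)[OF S T' that, of a b] ge ij by simp
  have "i + 1 \<le> d" using tableaux_le[OF T', of "(a, b)"] ij by simp
  then have reg: "{(i + 1, j), (i, j + 1), (i + 1, j + 1)} \<subseteq> region d"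
    using ge ij by (auto simp: region_def)
  have n1: "(i + 1, j) \<notin> moved_cells S T"
  proof
    assume "(i + 1, j) \<in> moved_cells S T"
    then obtain a' b' where v: "(a', b') \<in> S" "T (a', b') = i + 1" "a' + b = a + b' + 1"
      using ij by (auto simp: moved_cells_def)
    have ge': "1 \<le> a'" "1 \<le> b'" using diagramD(2,3)[OF S v(1)] by auto
    show False
    proof (cases "a' \<le> a")
      case True
      then show False using tableaux_mono(1)[OF S T u, of a' b'] ge' v ij by simp
    next
      case False
      then have "(a + 1, b) \<in> S" "T (a + 1, b) \<le> T (a', b')"
        using diagramD(4)[OF S v(1), of "a + 1" b] tableaux_mono(1)[OF S T v(1), of "a + 1" b] ge v by auto
      then show False using below v by simp
    qed
  qed
  have n2: "(i, j + 1) \<notin> moved_cells S T"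
  proof
    assume "(i, j + 1) \<in> moved_cells S T"
    then obtain a' b' where v: "(a', b') \<in> S" "T (a', b') = i" "a' + b + 1 = a + b'"
      using ij by (auto simp: moved_cells_def)
    have ge': "1 \<le> a'" "1 \<le> b'" using diagramD(2,3)[OF S v(1)] by auto
    show False
    proof (cases "a' < a")
      case True
      then show False using tableaux_mono(2)[OF S T u, of a' b'] ge' v ij by simp
    next
      case False
      then have "(a, b + 1) \<in> S" "T (a, b + 1) \<le> T (a', b')"
        using diagramD(4)[OF S v(1), of a "b + 1"] tableaux_mono(1)[OF S T v(1), of a "b + 1"] ge v by auto
      then show False using right v by simp
    qed
  qed
  have n3: "(i + 1, j + 1) \<notin> moved_cells S T"
  proof
    assume "(i + 1, j + 1) \<in> moved_cells S T"
    then obtain a' b' where v: "(a', b') \<in> S" "T (a', b') = i + 1" "a' + b = a + b'"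
      using ij by (auto simp: moved_cells_def)
    have ge': "1 \<le> a'" "1 \<le> b'" using diagramD(2,3)[OF S v(1)] by auto
    show False
    proof (cases "a' \<le> a")
      case True
      then show False using tableaux_mono(1)[OF S T u, of a' b'] ge' v ij by simp
    next
      case False
      then have "(a, b + 1) \<in> S" "T (a, b + 1) < T (a', b')"
        using diagramD(4)[OF S v(1), of a "b + 1"] tableaux_mono(2)[OF S T v(1), of a "b + 1"] ge v by auto
      then show False using right v by simp
    qed
  qed
  have in1: "(i, j) \<in> moved_cells S T" using u ij by (auto simp: moved_cells_def)
  have "moved_cells S ?T' = insert (i + 1, j + 1) (moved_cells S T - {(i, j)})" (is "?L = ?R")
  proof (intro set_eqI iffI)
    fix c assume "c \<in> ?L"
    then obtain a' b' where v: "(a', b') \<in> S" "fst c = ?T' (a', b')" "snd c + a' = fst c + b'"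
      by (auto simp: moved_cells_def)
    show "c \<in> ?R"
    proof (cases "(a', b') = (a, b)")
      case True
      then show ?thesis using v ij by (cases c) auto
    next
      case False
      then have m: "c \<in> moved_cells S T" "fst c = T (a', b')"
        using v by (cases c; auto simp: moved_cells_def)+
      have "c \<noteq> (i, j)"
      proof
        assume "c = (i, j)"
        then have e: "T (a', b') = T (a, b)" "a' + b = a + b'" using m v ij by auto
        then have "a' \<noteq> a" using False by auto
        then show False
          using tableaux_mono(2)[OF S T u, of a' b'] tableaux_mono(2)[OF S T v(1), of a b] e ge
            diagramD(2,3)[OF S v(1)] by (cases "a' < a") auto
      qed
      then show ?thesis using m by simp
    qed
  next
    fix c assume "c \<in> ?R"
    then consider "c = (i + 1, j + 1)" | "c \<in> moved_cells S T" "c \<noteq> (i, j)" by blast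
    then show "c \<in> ?L"
    proof cases
      case 1
      then show ?thesis using ij by (auto intro!: moved_cellsI[OF u])
    next
      case 2
      from 2(1) obtain a' b' where v: "(a', b') \<in> S" "fst c = T (a', b')"
        "snd c + a' = fst c + b'"
        by (auto simp: moved_cells_def)
      then have "(a', b') \<noteq> (a, b)" using 2(2) ij by (cases c) auto
      then have "fst c = ?T' (a', b')" using v by auto
      then have "(fst c, snd c) \<in> ?L" using v by (intro moved_cellsI[of a' b']) auto
      then show ?thesis by simp
    qed
  qed
  then show ?thesis
    using reg n1 n2 n3 in1 by (simp add: excited_move_def)
qed

text \<open>
  Increasing the entry \<open>i\<close> of \<open>(a, b)\<close> changes the least entries of two cells only, the neighbours
  to the right and below. This takes away the value \<open>i\<close> from the former and \<open>i + 1\<close> from the latter,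
  which are the positions that the rule for excited peaks deletes. These positions are not
  peaks of any other cell on their diagonals, by the monotonicity of the tableau.
\<close>

lemma peak_cells_move:
  assumes S: "diagram S" and T: "T \<in> tableaux S d" and u: "(a, b) \<in> S"
    and T': "T((a, b) := T (a, b) + 1) \<in> tableaux S d" and ij: "i = T (a, b)" "j + a = i + b"
  shows "peak_cells S (T((a, b) := T (a, b) + 1)) =
    (peak_cells S T \<union> {(i, j)}) - {(i, j + 1), (i + 1, j)}"
proof -
  define T' where "T' = T((a, b) := T (a, b) + 1)"
  have T'T: "T' \<in> tableaux S d" using T' by (simp add: T'_def)
  have val: "T' v = (if v = (a, b) then i + 1 else T v)" for v by (simp add: T'_def ij)
  have ge: "1 \<le> a" "1 \<le> b" using diagramD(2,3)[OF S u] by auto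
  have lo_u: "least_entry T' (a, b) = least_entry T (a, b)" using ge by (auto simp: val)
  have lo_u_le: "least_entry T (a, b) \<le> i" using least_entry_le[OF S T u] ij by simp
  have lo_mono: "least_entry T v \<le> least_entry T' v" for v
    by (cases v) (auto simp: val ij max_def)
  have lo_same: "least_entry T' v = least_entry T v" if "v \<noteq> (a, b + 1)" "v \<noteq> (a + 1, b)" for v
    using that ge by (cases v) (auto simp: val)
  have lo_lower: "T' (a', b') < least_entry T' (a'', b'')"
    if v: "(a'', b'') \<in> S" and "1 \<le> a'" "1 \<le> b'" "a' < a''" "b' \<le> b''" for a' b' a'' b''
  proof -
    have "(a'' - 1, b'') \<in> S" using diagramD(4)[OF S v, of "a'' - 1" b''] that by simp
    then have "T' (a', b') \<le> T' (a'' - 1, b'')"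
      using tableaux_mono(1)[OF S T'T, of "a'' - 1" b'' a' b'] that by simp
    then show ?thesis by simp
  qed
  have n1: "(i, j + 1) \<notin> peak_cells S T'"
  proof
    assume "(i, j + 1) \<in> peak_cells S T'"
    then obtain a' b' where v: "(a', b') \<in> S" "least_entry T' (a', b') \<le> i" "i < T' (a', b')"
      "a' + b + 1 = a + b'"
      using ij by (auto simp: peak_cells_def)
    have ge': "1 \<le> a'" "1 \<le> b'" using diagramD(2,3)[OF S v(1)] by auto
    consider "a' < a" | "a' = a" | "a < a'" by linarith
    then show False
    proof cases
      case 1
      then show False
        using tableaux_mono(2)[OF S T u, of a' b'] ge' v ij by (auto simp: val split: if_splits)
    next
      case 2
      then show False using v by (auto simp: val split: if_splits)
    next
      case 3
      then show False using lo_lower[OF v(1), of a b] ge v by (simp add: val del: least_entry.simps)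
    qed
  qed
  have n2: "(i + 1, j) \<notin> peak_cells S T'"
  proof
    assume "(i + 1, j) \<in> peak_cells S T'"
    then obtain a' b' where v: "(a', b') \<in> S" "least_entry T' (a', b') \<le> i + 1" "i + 1 < T' (a', b')"
      "a' + b = a + b' + 1"
      using ij by (auto simp: peak_cells_def)
    have ge': "1 \<le> a'" "1 \<le> b'" using diagramD(2,3)[OF S v(1)] by auto
    show False
    proof (cases "a' \<le> a")
      case True
      then show False
        using tableaux_mono(1)[OF S T u, of a' b'] ge' v ij by (auto simp: val split: if_splits)
    next
      case False
      then show False using lo_lower[OF v(1), of a b] ge v by (simp add: val del: least_entry.simps)
    qed
  qed
  have "peak_cells S T' = (peak_cells S T \<union> {(i, j)}) - {(i, j + 1), (i + 1, j)}"
  proof (intro set_eqI iffI)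
    fix c assume c: "c \<in> peak_cells S T'"
    then obtain a' b' where v: "(a', b') \<in> S" "least_entry T' (a', b') \<le> fst c"
      "fst c < T' (a', b')" "snd c + a' = fst c + b'"
      by (auto simp: peak_cells_def)
    have "c \<in> peak_cells S T \<or> c = (i, j)"
    proof (cases "(a', b') = (a, b) \<and> fst c = i")
      case True
      then show ?thesis using v ij by (cases c) auto
    next
      case False
      then have "fst c < T (a', b')" using v(3) ij by (auto simp: val split: if_splits)
      moreover have "least_entry T (a', b') \<le> fst c" using lo_mono[of "(a', b')"] v(2) by linarith
      ultimately have "c \<in> peak_cells S T"
        using v(1,4) unfolding peak_cells_def by (cases c) (auto simp del: least_entry.simps)
      then show ?thesis ..
    qed
    then show "c \<in> (peak_cells S T \<union> {(i, j)}) - {(i, j + 1), (i + 1, j)}"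
      using c n1 n2 by auto
  next
    fix c assume c: "c \<in> (peak_cells S T \<union> {(i, j)}) - {(i, j + 1), (i + 1, j)}"
    have uin: "c \<in> peak_cells S T'" if "c = (i, j)"
      using that u lo_u lo_u_le ij unfolding peak_cells_def
      by (auto simp: val simp del: least_entry.simps)
    show "c \<in> peak_cells S T'"
    proof (cases "c = (i, j)")
      case False
      then obtain a' b' where v: "(a', b') \<in> S" "least_entry T (a', b') \<le> fst c"
        "fst c < T (a', b')" "snd c + a' = fst c + b'"
      proof -
        have "c \<in> peak_cells S T" using c False by simp
        then show ?thesis using that by (auto simp: peak_cells_def simp del: least_entry.simps)
      qed
      have "fst c < T' (a', b')" using v(3) ij by (auto simp: val)
      moreover have "least_entry T' (a', b') \<le> fst c"
      proof (rule ccontr)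
        assume lt: "\<not> least_entry T' (a', b') \<le> fst c"
        then consider "(a', b') = (a, b + 1)" | "(a', b') = (a + 1, b)"
          using lo_same[of "(a', b')"] v(2) by fastforce
        then show False
        proof cases
          case 1
          then have "fst c = i" using lt v(2) ij by (auto simp: val)
          then have "c = (i, j + 1)" using v(4) 1 ij by (cases c) auto
          then show False using c by simp
        next
          case 2
          then have "fst c = i + 1" using lt v(2) ij by (auto simp: val)
          then have "c = (i + 1, j)" using v(4) 2 ij by (cases c) auto
          then show False using c by simp
        qed
      qed
      ultimately show ?thesis
        using v(1,4) unfolding peak_cells_def by (cases c) (auto simp del: least_entry.simps)
    qed (rule uin)
  qed
  then show ?thesis by (simp add: T'_def)
qed

text \<open>
  The two free positions next to a cell that can move are on the diagonals of its neighbours to the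
  right and below, which are therefore too far ahead to obstruct the new entry.
\<close>

lemma excited_move_tableau:
  assumes S: "diagram S" and T: "T \<in> tableaux S d"
    and mv: "excited_move d (i, j) (moved_cells S T) D'"
  obtains a b where "(a, b) \<in> S" "T((a, b) := T (a, b) + 1) \<in> tableaux S d"
    "i = T (a, b)" "j + a = i + b" "D' = moved_cells S (T((a, b) := T (a, b) + 1))"
proof -
  have mvd: "(i, j) \<in> moved_cells S T" "(i + 1, j) \<notin> moved_cells S T"
    "(i, j + 1) \<notin> moved_cells S T" "i + 1 \<le> d"
    "D' = insert (i + 1, j + 1) (moved_cells S T - {(i, j)})"
    using mv by (auto simp: excited_move_def region_def)
  obtain a b where u: "(a, b) \<in> S" and ij: "i = T (a, b)" "j + a = i + b"
    using mvd(1) by (auto simp: moved_cells_def)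
  define T' where "T' = T((a, b) := T (a, b) + 1)"
  have val: "T' v = (if v = (a, b) then i + 1 else T v)" for v by (simp add: T'_def ij)
  have ge: "1 \<le> a" "1 \<le> b" using diagramD(2,3)[OF S u] by auto
  have right: "i + 1 \<le> T (a, b + 1)" if v: "(a, b + 1) \<in> S"
  proof -
    have "T (a, b + 1) \<noteq> i"
    proof
      assume "T (a, b + 1) = i"
      then have "(i, j + 1) \<in> moved_cells S T"
        using ij by (intro moved_cellsI[OF v]) auto
      then show False using mvd(3) by blast
    qed
    then show ?thesis using tableaux_mono(1)[OF S T v, of a b] ge ij by simp
  qed
  have below: "i + 2 \<le> T (a + 1, b)" if v: "(a + 1, b) \<in> S"
  proof -
    have "T (a + 1, b) \<noteq> i + 1"
    proof
      assume "T (a + 1, b) = i + 1"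
      then have "(i + 1, j) \<in> moved_cells S T"
        using ij by (intro moved_cellsI[OF v]) auto
      then show False using mvd(2) by blast
    qed
    then show ?thesis using tableaux_mono(2)[OF S T v, of a b] ge ij by simp
  qed
  have T'T: "T' \<in> tableaux S d"
    unfolding tableaux_iff_least_entry[OF S]
  proof (intro conjI ballI allI impI)
    fix v assume v: "v \<in> S"
    show "T' v \<le> d" using tableaux_le[OF T, of v] mvd(4) by (simp add: val)
    have lo: "least_entry T v \<le> T v" by (rule least_entry_le[OF S T v])
    obtain x y where xy: "v = (x, y)" by fastforce
    consider "v = (a, b + 1)" | "v = (a + 1, b)" | "v \<noteq> (a, b + 1)" "v \<noteq> (a + 1, b)" by blast
    then show "least_entry T' v \<le> T' v"
    proof cases
      case 1
      then show ?thesis using lo right v by (auto simp: val)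
    next
      case 2
      then show ?thesis using lo below v by (auto simp: val)
    next
      case 3
      have "least_entry T' v = least_entry T v" using 3 ge xy by (auto simp: val)
      with lo have "least_entry T' v \<le> T v" by (simp only:)
      also have "T v \<le> T' v" using ij by (simp add: val)
      finally show ?thesis .
    qed
  next
    fix v assume "v \<notin> S"
    then show "T' v = 0" using tableaux_zero[OF T, of v] u by (auto simp: val)
  qed
  have "D' = moved_cells S T'"
    using moved_cells_move[OF S T u T'T[unfolded T'_def] ij] mvd(5)
    by (simp add: excited_move_def T'_def)
  then show ?thesis using that[OF u] T'T ij by (simp add: T'_def)
qed

text \<open>
  The smallest tableau; it encodes the diagram before any move.
\<close>

definition row_tableau :: "cell set \<Rightarrow> cell \<Rightarrow> nat" where
  "row_tableau S u = (if u \<in> S then fst u else 0)"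

lemma row_tableau:
  assumes S: "diagram S" and d: "\<And>i j. (i, j) \<in> S \<Longrightarrow> i \<le> d"
  shows "row_tableau S \<in> tableaux S d" and "moved_cells S (row_tableau S) = S"
    and "peak_cells S (row_tableau S) = {}"
proof -
  have lo: "least_entry (row_tableau S) (i, j) = i" if "(i, j) \<in> S" for i j
    using that diagramD(2,3)[OF S that] diagramD(4)[OF S that, of "i - 1" j]
    by (cases "i = 1") (auto simp: row_tableau_def)
  show "row_tableau S \<in> tableaux S d"
    unfolding tableaux_iff_least_entry[OF S]
  proof (intro conjI ballI allI impI)
    fix u assume u: "u \<in> S"
    obtain i j where ij: "u = (i, j)" by fastforce
    show "least_entry (row_tableau S) u \<le> row_tableau S u" "row_tableau S u \<le> d"
      using lo[of i j] d[of i j] u ij by (simp_all add: row_tableau_def del: least_entry.simps)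
  qed (simp add: row_tableau_def)
  show "moved_cells S (row_tableau S) = S"
  proof (intro set_eqI iffI)
    fix u assume "u \<in> moved_cells S (row_tableau S)"
    then obtain a b where "(a, b) \<in> S" "fst u = row_tableau S (a, b)" "snd u + a = fst u + b"
      by (auto simp: moved_cells_def)
    then show "u \<in> S" by (cases u) (simp add: row_tableau_def)
  next
    fix u assume "u \<in> S"
    then show "u \<in> moved_cells S (row_tableau S)"
      by (cases u) (auto simp: row_tableau_def intro: moved_cellsI)
  qed
  show "peak_cells S (row_tableau S) = {}"
    using lo by (auto simp: peak_cells_def row_tableau_def simp del: least_entry.simps)
qed

lemma peaks_tableau:
  assumes mu: "is_partition mu" and d: "length mu \<le> d" and "peaks d mu D P"
  shows "\<exists>T\<in>tableaux (young mu) d. D = moved_cells (young mu) T \<and> P = peak_cells (young mu) T"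
  using assms(3)
proof induction
  case start
  have "i \<le> d" if "(i, j) \<in> young mu" for i j
    using that d by (auto simp: young_def)
  then show ?case
    using row_tableau[OF diagram_young[OF mu], of d] by metis
next
  case (move D P i j D')
  then obtain T where T: "T \<in> tableaux (young mu) d" "D = moved_cells (young mu) T"
    "P = peak_cells (young mu) T" by blast
  obtain a b where ab: "(a, b) \<in> young mu" "T((a, b) := T (a, b) + 1) \<in> tableaux (young mu) d"
    "i = T (a, b)" "j + a = i + b" "D' = moved_cells (young mu) (T((a, b) := T (a, b) + 1))"
    using excited_move_tableau[OF diagram_young[OF mu] T(1)] move.hyps(2) T(2) by metis
  then show ?case
    using peak_cells_move[OF diagram_young[OF mu] T(1) ab(1-4)] T(3) by metis
qed

lemma excited_diagrams_peaks:
  "D \<in> excited_diagrams d mu \<Longrightarrow> \<exists>P. peaks d mu D P"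
proof (induction rule: excited_diagrams.induct)
  case start
  then show ?case using peaks.start by blast
next
  case (move D u D')
  then show ?case by (cases u) (blast intro: peaks.move)
qed

text \<open>
  Among the cells whose entry exceeds their row number, one closest to the origin can be moved back,
  because its neighbours to the left and above have not moved at all.
\<close>

lemma moved_cells_excited:
  assumes mu: "is_partition mu" and d: "length mu \<le> d" and T: "T \<in> tableaux (young mu) d"
  shows "moved_cells (young mu) T \<in> excited_diagrams d mu"
  using T
proof (induction "\<Sum>u\<in>young mu. T u" arbitrary: T rule: less_induct)
  case less
  let ?S = "young mu"
  have S: "diagram ?S" by (rule diagram_young[OF mu])
  have dS: "i \<le> d" if "(i, j) \<in> ?S" for i j
    using that d by (auto simp: young_def)
  show ?case
  proof (cases "\<exists>n a b. (a, b) \<in> ?S \<and> a < T (a, b) \<and> n = a + b")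
    case False
    have "T u = row_tableau ?S u" for u
    proof (cases "u \<in> ?S")
      case True
      obtain a b where "u = (a, b)" by fastforce
      then show ?thesis
        using True False tableaux_row_le[OF S less.prems, of a b]
        by (simp add: row_tableau_def) (metis le_neq_implies_less)
    qed (use tableaux_zero[OF less.prems] in \<open>simp add: row_tableau_def\<close>)
    then have "T = row_tableau ?S" by blast
    then show ?thesis
      using row_tableau(2)[OF S dS] excited_diagrams.start by simp
  next
    case True
    define n where "n = (LEAST n. \<exists>a b. (a, b) \<in> ?S \<and> a < T (a, b) \<and> n = a + b)"
    obtain a b where ab: "(a, b) \<in> ?S" "a < T (a, b)" "n = a + b"
      using LeastI_ex[OF True] unfolding n_def by blast
    have least: "T (a', b') = a'" if "(a', b') \<in> ?S" "a' + b' < n" for a' b'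
    proof -
      have "\<not> a' < T (a', b')"
        using that not_less_Least[of "a' + b'" "\<lambda>n. \<exists>a b. (a, b) \<in> ?S \<and> a < T (a, b) \<and> n = a + b"]
        unfolding n_def by blast
      then show ?thesis using tableaux_row_le[OF S less.prems that(1)] by simp
    qed
    have ge: "1 \<le> a" "1 \<le> b" using diagramD(2,3)[OF S ab(1)] by auto
    define T' where "T' = T((a, b) := T (a, b) - 1)"
    have val: "T' v = (if v = (a, b) then T (a, b) - 1 else T v)" for v by (simp add: T'_def)
    have T'T: "T' \<in> tableaux ?S d"
      unfolding tableaux_iff_least_entry[OF S]
    proof (intro conjI ballI allI impI)
      fix v assume v: "v \<in> ?S"
      show "T' v \<le> d"
        using tableaux_le[OF less.prems, of v] tableaux_le[OF less.prems, of "(a, b)"]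
        by (auto simp: val)
      show "least_entry T' v \<le> T' v"
      proof (cases "v = (a, b)")
        case True
        have "T (a, b - 1) \<le> a"
          using least[of a "b - 1"] tableaux_zero[OF less.prems, of "(a, b - 1)"] ab ge
          by (cases "(a, b - 1) \<in> ?S") auto
        moreover have "T (a - 1, b) \<le> a - 1"
          using least[of "a - 1" b] tableaux_zero[OF less.prems, of "(a - 1, b)"] ab ge
          by (cases "(a - 1, b) \<in> ?S") auto
        ultimately show ?thesis using True ab ge by (auto simp: val)
      next
        case False
        have "least_entry T' v \<le> least_entry T v"
          by (cases v) (auto simp: val max_def)
        also have "\<dots> \<le> T v" by (rule least_entry_le[OF S less.prems v])
        finally show ?thesis using False by (simp add: val)
      qed
    next
      fix v assume "v \<notin> ?S"
      then show "T' v = 0" using tableaux_zero[OF less.prems, of v] ab by (auto simp: val)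
    qed
    have "(\<Sum>u\<in>?S. T' u) < (\<Sum>u\<in>?S. T u)"
      using diagramD(1)[OF S] ab by (intro sum_strict_mono_ex1) (auto simp: val intro!: bexI[of _ "(a, b)"])
    then have ex: "moved_cells ?S T' \<in> excited_diagrams d mu"
      using T'T by (rule less.hyps)
    have restore: "T'((a, b) := T' (a, b) + 1) = T" using ab by (auto simp: T'_def)
    have "excited_move d (T' (a, b), T' (a, b) + b - a) (moved_cells ?S T') (moved_cells ?S T)"
      using moved_cells_move[OF S T'T ab(1), of "T' (a, b)" "T' (a, b) + b - a", unfolded restore]
        less.prems tableaux_row_le[OF S T'T ab(1)] by simp
    then show ?thesis by (rule excited_diagrams.move[OF ex])
  qed
qed

text \<open>
  Every sequence of moves leads to the peaks that are read off from some tableau, and the tableau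
  is determined by the diagram. In particular the peaks do not depend on the sequence.
\<close>

lemma excited_peaks_moved_cells:
  assumes mu: "is_partition mu" and d: "length mu \<le> d" and T: "T \<in> tableaux (young mu) d"
  shows "excited_peaks d mu (moved_cells (young mu) T) = peak_cells (young mu) T"
proof -
  have det: "P = peak_cells (young mu) T" if "peaks d mu (moved_cells (young mu) T) P" for P
    using peaks_tableau[OF mu d that] moved_cells_inj[OF diagram_young[OF mu] T] by metis
  obtain P where "peaks d mu (moved_cells (young mu) T) P"
    using excited_diagrams_peaks[OF moved_cells_excited[OF mu d T]] by blast
  then show ?thesis
    unfolding excited_peaks_def using det by (intro the_equality) auto
qed

section \<open>Summing over excited diagrams\<close>

lemma entry_less_least_entry_diagonal:
  assumes S: "diagram S" and T: "T \<in> tableaux S d"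
    and u: "(a, b) \<in> S" and v: "(a', b') \<in> S" and less: "a < a'" and diag: "a + b' = a' + b"
  shows "T (a, b) < least_entry T (a', b')"
proof -
  have ge: "1 \<le> a" "1 \<le> b" using diagramD(2,3)[OF S u] by auto
  have "(a' - 1, b') \<in> S" using diagramD(4)[OF S v, of "a' - 1" b'] ge less diag by simp
  then have "T (a, b) \<le> T (a' - 1, b')"
    using tableaux_mono(1)[OF S T, of "a' - 1" b' a b] ge less diag by simp
  then show ?thesis by simp
qed

lemma row_le_least_entry:
  assumes S: "diagram S" and T: "T \<in> tableaux S d" and u: "(a, b) \<in> S"
  shows "a \<le> least_entry T (a, b)"
proof (cases "a \<le> 1")
  case False
  then have "(a - 1, b) \<in> S"
    using diagramD(4)[OF S u, of "a - 1" b] diagramD(3)[OF S u] by simp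
  then show ?thesis using tableaux_row_le[OF S T, of "a - 1" b] by simp
qed simp

text \<open>
  The subtraction does not truncate, because an excited move never takes a cell above its original row.
\<close>

definition diagonal_cell :: "cell \<Rightarrow> nat \<Rightarrow> cell" where
  "diagonal_cell u k = (k, k + snd u - fst u)"

lemma weight_diagonal_cell:
  "fst u \<le> k \<Longrightarrow> weight lam (diagonal_cell u k) = box_weight lam u k"
  by (cases u) (simp add: weight_def diagonal_cell_def box_weight_def content_def)

text \<open>
  The values skipped by different cells on the same diagonal lie in disjoint intervals, so every peak
  belongs to exactly one cell of \<open>mu\<close>.
\<close>

lemma peak_weight_eq:
  assumes mu: "is_partition mu" and le: "length mu \<le> length lam"
    and T: "T \<in> tableaux (young mu) (length lam)"
  shows "peak_weight lam mu (moved_cells (young mu) T) =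
    (\<Sum>u\<in>young mu. \<Sum>k\<in>{least_entry T u..<T u}. box_weight lam u k)"
proof -
  let ?S = "young mu"
  let ?P = "Sigma ?S (\<lambda>u. {least_entry T u..<T u})"
  have S: "diagram ?S" by (rule diagram_young[OF mu])
  have row: "fst u \<le> k" if "(u, k) \<in> ?P" for u k
    using that row_le_least_entry[OF S T, of "fst u" "snd u"] by simp
  have inj: "inj_on (\<lambda>(u, k). diagonal_cell u k) ?P"
  proof (rule inj_onI)
    fix p p'
    assume P: "p \<in> ?P" "p' \<in> ?P"
      and eq': "(case p of (u, k) \<Rightarrow> diagonal_cell u k) = (case p' of (u, k) \<Rightarrow> diagonal_cell u k)"
    obtain a b k a' b' k' where pp: "p = ((a, b), k)" "p' = ((a', b'), k')"
      by (metis prod.exhaust)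
    have p: "(a, b) \<in> ?S" "k \<in> {least_entry T (a, b)..<T (a, b)}"
      and p': "(a', b') \<in> ?S" "k' \<in> {least_entry T (a', b')..<T (a', b')}"
      and eq: "diagonal_cell (a, b) k = diagonal_cell (a', b') k'"
      using P eq' by (simp_all add: pp)
    have "a \<le> k" "a' \<le> k'" using row[of "(a, b)" k] row[of "(a', b')" k'] p p' by auto
    then have e: "k = k'" "a + b' = a' + b" using eq by (auto simp: diagonal_cell_def)
    have "\<not> a < a'" "\<not> a' < a"
      using entry_less_least_entry_diagonal[OF S T p(1) p'(1)]
        entry_less_least_entry_diagonal[OF S T p'(1) p(1)] p(2) p'(2) e
      by (auto simp del: least_entry.simps)
    then show "p = p'" using e by (simp add: pp)
  qed
  have img: "peak_cells ?S T = (\<lambda>(u, k). diagonal_cell u k) ` ?P"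
  proof (intro set_eqI iffI)
    fix c assume "c \<in> peak_cells ?S T"
    then obtain a b where v: "(a, b) \<in> ?S" "least_entry T (a, b) \<le> fst c"
      "fst c < T (a, b)" "snd c + a = fst c + b"
      by (auto simp: peak_cells_def simp del: least_entry.simps)
    then have "c = diagonal_cell (a, b) (fst c)" by (cases c) (simp add: diagonal_cell_def)
    then show "c \<in> (\<lambda>(u, k). diagonal_cell u k) ` ?P"
      using v by (intro image_eqI[of _ _ "((a, b), fst c)"]) (auto simp del: least_entry.simps)
  next
    fix c assume "c \<in> (\<lambda>(u, k). diagonal_cell u k) ` ?P"
    then obtain a b k where v: "((a, b), k) \<in> ?P" "c = diagonal_cell (a, b) k" by auto
    then have "snd c + a = fst c + b" "fst c = k"
      using row[OF v(1)] by (auto simp: diagonal_cell_def)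
    then show "c \<in> peak_cells ?S T"
      using v(1) unfolding peak_cells_def by (cases c) (auto simp del: least_entry.simps)
  qed
  have "peak_weight lam mu (moved_cells ?S T) = (\<Sum>(u, k)\<in>?P. weight lam (diagonal_cell u k))"
    unfolding peak_weight_def excited_peaks_moved_cells[OF mu le T] img
    by (subst sum.reindex[OF inj]) (simp add: case_prod_beta' o_def)
  also have "\<dots> = (\<Sum>(u, k)\<in>?P. box_weight lam u k)"
  proof (rule sum.cong[OF refl])
    fix p assume p: "p \<in> ?P"
    obtain u k where "p = (u, k)" by fastforce
    then show "(case p of (u, k) \<Rightarrow> weight lam (diagonal_cell u k)) =
        (case p of (u, k) \<Rightarrow> box_weight lam u k)"
      using weight_diagonal_cell[OF row] p by simp
  qed
  also have "\<dots> = (\<Sum>u\<in>?S. \<Sum>k\<in>{least_entry T u..<T u}. box_weight lam u k)"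
    using diagramD(1)[OF S] by (intro sum.Sigma[symmetric]) auto
  finally show ?thesis .
qed

lemma prod_moved_cells_weight:
  assumes S: "diagram S" and T: "T \<in> tableaux S d"
  shows "(\<Prod>c\<in>moved_cells S T. f (weight lam c)) = (\<Prod>u\<in>S. f (box_weight lam u (T u)))"
proof -
  have inj: "inj_on (\<lambda>u. diagonal_cell u (T u)) S"
  proof (rule inj_onI, clarify)
    fix a b a' b'
    assume u: "(a, b) \<in> S" and v: "(a', b') \<in> S"
      and eq: "diagonal_cell (a, b) (T (a, b)) = diagonal_cell (a', b') (T (a', b'))"
    have "a \<le> T (a, b)" "a' \<le> T (a', b')"
      using tableaux_row_le[OF S T] u v by blast+
    then have e: "T (a, b) = T (a', b')" "a + b' = a' + b" using eq by (auto simp: diagonal_cell_def)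
    have "\<not> a < a'" "\<not> a' < a"
      using entry_less_least_entry_diagonal[OF S T u v] entry_less_least_entry_diagonal[OF S T v u]
        least_entry_le[OF S T u] least_entry_le[OF S T v] e
      by (auto simp del: least_entry.simps)
    then show "a = a' \<and> b = b'" using e by simp
  qed
  have img: "moved_cells S T = (\<lambda>u. diagonal_cell u (T u)) ` S"
  proof (intro set_eqI iffI)
    fix c assume "c \<in> moved_cells S T"
    then obtain a b where v: "(a, b) \<in> S" "fst c = T (a, b)" "snd c + a = fst c + b"
      by (auto simp: moved_cells_def)
    then have "c = diagonal_cell (a, b) (T (a, b))" by (cases c) (simp add: diagonal_cell_def)
    then show "c \<in> (\<lambda>u. diagonal_cell u (T u)) ` S" using v(1) by blast
  next
    fix c assume "c \<in> (\<lambda>u. diagonal_cell u (T u)) ` S"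
    then obtain a b where v: "(a, b) \<in> S" "c = diagonal_cell (a, b) (T (a, b))" by auto
    then show "c \<in> moved_cells S T"
      using tableaux_row_le[OF S T v(1)] by (auto simp: diagonal_cell_def intro!: moved_cellsI)
  qed
  show ?thesis
    unfolding img using tableaux_row_le[OF S T]
    by (subst prod.reindex[OF inj]) (auto intro!: prod.cong simp: weight_diagonal_cell)
qed

lemma oot_iff:
  "T \<in> oot lam mu \<longleftrightarrow>
    T \<in> tableaux (young mu) (length lam) \<and> (\<forall>u\<in>young mu. 0 < box_weight lam u (T u))"
  by (simp add: oot_def ssyt_def tableaux_def box_weight_def)

lemma ooe_eq_image:
  assumes mu: "is_partition mu" and le: "length mu \<le> length lam"
  shows "ooe lam mu = moved_cells (young mu) ` oot lam mu"
proof -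
  have "tableau_diagram mu T = moved_cells (young mu) T"
    "moved_cells (young mu) T \<in> excited_diagrams (length lam) mu" if "T \<in> oot lam mu" for T
    using that tableau_diagram_eq_moved_cells[OF mu] moved_cells_excited[OF mu le]
    unfolding oot_iff by blast+
  then show ?thesis unfolding ooe_def by auto
qed

text \<open>
  The tableaux that are excluded from the left-hand side contain a cell of nonpositive weight. They
  do not affect the sum, because then some cell has weight 0 and contributes the factor
  \<open>1 - q powi 0\<close>.
\<close>

lemma sum_ooe_eq_wsum:
  fixes q :: "'a::field"
  assumes q: "q \<noteq> 0" and lam: "is_partition lam" and mu: "is_partition mu"
    and le: "length mu \<le> length lam"
  shows "(\<Sum>D\<in>ooe lam mu. q powi peak_weight lam mu D * (\<Prod>u\<in>D. 1 - q powi weight lam u)) =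
    wsum (\<lambda>u k. q powi box_weight lam u k) (length lam) (young mu)"
proof -
  let ?S = "young mu" and ?d = "length lam" and ?z = "\<lambda>u k. q powi box_weight lam u k"
  have S: "diagram ?S" by (rule diagram_young[OF mu])
  have inj: "inj_on (moved_cells ?S) (oot lam mu)"
    using moved_cells_inj[OF S] by (auto simp: inj_on_def oot_iff)
  have summand: "q powi peak_weight lam mu (moved_cells ?S T) *
      (\<Prod>u\<in>moved_cells ?S T. 1 - q powi weight lam u) = wmax ?z ?S T"
    if T: "T \<in> tableaux ?S ?d" for T
    unfolding peak_weight_eq[OF mu le T] wmax_def
      prod_moved_cells_weight[OF S T, where f = "\<lambda>w. 1 - q powi w"]
    by (simp add: prod_power_int[OF q] prod.distrib mult.commute)
  have "(\<Sum>D\<in>ooe lam mu. q powi peak_weight lam mu D * (\<Prod>u\<in>D. 1 - q powi weight lam u)) =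
      (\<Sum>T\<in>oot lam mu. wmax ?z ?S T)"
    unfolding ooe_eq_image[OF mu le] sum.reindex[OF inj]
    by (intro sum.cong refl) (simp add: summand oot_iff)
  also have "\<dots> = (\<Sum>T\<in>tableaux ?S ?d. wmax ?z ?S T)"
  proof (rule sum.mono_neutral_left)
    show "\<forall>T\<in>tableaux ?S ?d - oot lam mu. wmax ?z ?S T = 0"
    proof
      fix T assume T: "T \<in> tableaux ?S ?d - oot lam mu"
      then obtain i j where "(i, j) \<in> ?S" "box_weight lam (i, j) (T (i, j)) \<le> 0"
        by (auto simp: oot_iff not_less)
      then obtain v where "v \<in> ?S" "box_weight lam v (T v) = 0"
        using exists_zero_box_weight[OF lam S] T by blast
      then show "wmax ?z ?S T = 0" by (rule wmax_eq_0[OF diagramD(1)[OF S]])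
    qed
  qed (use finite_tableaux[OF S] in \<open>auto simp: oot_iff\<close>)
  finally show ?thesis by (simp add: wsum_def)
qed

theorem theorem8p16:
  fixes lam mu :: "nat list"
  assumes "is_partition lam" and "is_partition mu" and "young mu \<subseteq> young lam"
  shows "fps_to_fls (rpp_gf (young lam - young mu)) / fps_to_fls (rpp_gf (young lam)) =
    (\<Sum>D \<in> ooe lam mu. fls_X powi (peak_weight lam mu D) *
       (\<Prod>u\<in>D. 1 - fls_X powi (weight lam u)))"
proof -
  have "length mu \<le> length lam"
  proof (cases "length mu = 0")
    case False
    then have "1 \<le> length mu" by linarith
    then have "(length mu, 1) \<in> young mu"
      using part_pos[OF assms(2), of "length mu"] by (simp add: mem_young)
    then show ?thesis using assms(3) by (auto simp: young_def)
  qed simp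
  then show ?thesis
    unfolding rpp_gf_quotient[OF assms(1) diagram_young[OF assms(2)] assms(3)]
    by (intro sum_ooe_eq_wsum[symmetric] assms) auto
qed

end
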